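(* Let $T$ be a strongly cartesian monad on a finitely complete category $\mathcal{E}$. Any dense generator $\mathcal{A}$ of $\mathcal{E}$ embeds in a minimal $T$-generically closed dense generator $\mathcal{A}_T$. In particular, any $T$-cartesian monad on $\mathcal{E}$ has arities $\mathcal{A}_T$.
   Context: All categories are locally small; $\widehat{\mathcal{A}}$ denotes set-valued presheaves on $\mathcal{A}$. A dense generator of $\mathcal{E}$ is a small full subcategory $i_{\mathcal{A}}:\mathcal{A}\hookrightarrow\mathcal{E}$ such that the nerve functor $\nu_{\mathcal{A}}:\mathcal{E}\to\widehat{\mathcal{A}}$, $\nu_{\mathcal{A}}(X)(A)=\mathcal{E}(i_{\mathcal{A}}(A),X)$, is fully faithful. For $X$ in $\mathcal{E}$, $\mathcal{A}/X$ is the full subcategory of $\mathcal{E}/X$ on the arrows $A\to X$ with $A$ in $\mathcal{A}$; the $\mathcal{A}$-cocone over $X$ is the canonical natural transformation from the projection $\mathcal{A}/X\to\mathcal{E}$ to the constant functor at $X$. A monad $S$ on $\mathcal{E}$ has arities $\mathcal{A}$ if $\nu_{\mathcal{A}}S$ takes the $\mathcal{A}$-cocones to colimit-cocones in $\widehat{\mathcal{A}}$. A functor $R:\mathcal{E}\to\mathcal{F}$ is a local right adjoint if for each object $X$ of $\mathcal{E}$ the induced functor $\mathcal{E}/X\to\mathcal{F}/RX$, $f\mapsto R(f)$, admits a left adjoint. A monad $T$ on a category with pullbacks is cartesian if $T$ preserves pullbacks and all naturality squares of its unit and multiplication are pullbacks; it is strongly cartesian if moreover the underlying endofunctor is a local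 right adjoint. A $T$-cartesian monad is a monad $S$ on $\mathcal{E}$ equipped with a monad morphism $S\Rightarrow T$ (a natural transformation compatible with units and multiplications) all of whose naturality squares are pullbacks. A morphism $g:B\to TA$ is $T$-generic if for all $\alpha:B\to TA'$, $\beta:A\to X$, $\gamma:A'\to X$ with $T(\gamma)\alpha=T(\beta)g$ there is a unique $\delta:A\to A'$ with $T(\delta)g=\alpha$ and $\gamma\delta=\beta$. A generator $\mathcal{A}$ of $\mathcal{E}$ is $T$-generically closed if for any $T$-generic morphism $B\to TA$ with $B$ in $\mathcal{A}$ there is an object isomorphic to $A$ which belongs to $\mathcal{A}$. Minimality of $\mathcal{A}_T$ is understood up to isomorphism of objects, among $T$-generically closed dense generators containing $\mathcal{A}$. *)

theory Defs
  imports Main "HOL-Library.FuncSet"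
begin

unbundle cardinal_syntax

section \<open>Size\<close>

text \<open>
  The universe of small sets is represented by a type \<open>'u\<close> whose cardinal \<open>\<kappa>\<close> is infinite and
  regular: a set is small if it has fewer than \<open>\<kappa>\<close> elements, and, up to bijection, the small sets
  are the small subsets of \<open>'u\<close>. Grothendieck universes are the case of an inaccessible \<open>\<kappa>\<close>;
  the remaining closure properties of an inaccessible cardinal are not required.
\<close>

definition small_universe :: "'u itself \<Rightarrow> bool" where
  "small_universe _ \<longleftrightarrow> infinite (UNIV :: 'u set) \<and> regularCard |UNIV :: 'u set|"

definition small :: "'u itself \<Rightarrow> 'x set \<Rightarrow> bool" where
  "small _ X \<longleftrightarrow> |X| <o |UNIV :: 'u set|"


section \<open>Categories, functors, natural transformations\<close>

text \<open>
  Hom-sets are indexed by pairs of objects and need not be disjoint; so composition and the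
  action of functors on arrows carry the objects as arguments. \<open>Comp C X Y Z g f\<close> is the composite
  of \<open>f : X \<rightarrow> Y\<close> and \<open>g : Y \<rightarrow> Z\<close>. Values of the operations outside their intended domain
  are irrelevant.
\<close>

record ('o, 'a) cat =
  Obj :: "'o set"
  Hom :: "'o \<Rightarrow> 'o \<Rightarrow> 'a set"
  Id :: "'o \<Rightarrow> 'a"
  Comp :: "'o \<Rightarrow> 'o \<Rightarrow> 'o \<Rightarrow> 'a \<Rightarrow> 'a \<Rightarrow> 'a"

locale category =
  fixes C :: "('o, 'a) cat"
  assumes Id_in_Hom: "X \<in> Obj C \<Longrightarrow> Id C X \<in> Hom C X X"
    and Comp_in_Hom: "\<lbrakk>X \<in> Obj C; Y \<in> Obj C; Z \<in> Obj C; f \<in> Hom C X Y; g \<in> Hom C Y Z\<rbrakk>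
      \<Longrightarrow> Comp C X Y Z g f \<in> Hom C X Z"
    and Comp_Id_right: "\<lbrakk>X \<in> Obj C; Y \<in> Obj C; f \<in> Hom C X Y\<rbrakk>
      \<Longrightarrow> Comp C X X Y f (Id C X) = f"
    and Comp_Id_left: "\<lbrakk>X \<in> Obj C; Y \<in> Obj C; f \<in> Hom C X Y\<rbrakk>
      \<Longrightarrow> Comp C X Y Y (Id C Y) f = f"
    and Comp_assoc: "\<lbrakk>W \<in> Obj C; X \<in> Obj C; Y \<in> Obj C; Z \<in> Obj C;
        f \<in> Hom C W X; g \<in> Hom C X Y; h \<in> Hom C Y Z\<rbrakk>
      \<Longrightarrow> Comp C W Y Z h (Comp C W X Y g f) = Comp C W X Z (Comp C X Y Z h g) f"

record ('o, 'a, 'p, 'b) func =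
  OMap :: "'o \<Rightarrow> 'p"
  AMap :: "'o \<Rightarrow> 'o \<Rightarrow> 'a \<Rightarrow> 'b"

locale is_functor = C: category C + D: category D
  for C :: "('o, 'a) cat" and D :: "('p, 'b) cat" +
  fixes F :: "('o, 'a, 'p, 'b) func"
  assumes OMap_in_Obj: "X \<in> Obj C \<Longrightarrow> OMap F X \<in> Obj D"
    and AMap_in_Hom: "\<lbrakk>X \<in> Obj C; Y \<in> Obj C; f \<in> Hom C X Y\<rbrakk>
      \<Longrightarrow> AMap F X Y f \<in> Hom D (OMap F X) (OMap F Y)"
    and AMap_Id: "X \<in> Obj C \<Longrightarrow> AMap F X X (Id C X) = Id D (OMap F X)"
    and AMap_Comp: "\<lbrakk>X \<in> Obj C; Y \<in> Obj C; Z \<in> Obj C; f \<in> Hom C X Y; g \<in> Hom C Y Z\<rbrakk>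
      \<Longrightarrow> AMap F X Z (Comp C X Y Z g f) =
          Comp D (OMap F X) (OMap F Y) (OMap F Z) (AMap F Y Z g) (AMap F X Y f)"

locale nat_trans = F: is_functor C D F + G: is_functor C D G
  for C :: "('o, 'a) cat" and D :: "('p, 'b) cat"
    and F :: "('o, 'a, 'p, 'b) func" and G :: "('o, 'a, 'p, 'b) func" +
  fixes \<tau> :: "'o \<Rightarrow> 'b"
  assumes component_in_Hom: "X \<in> Obj C \<Longrightarrow> \<tau> X \<in> Hom D (OMap F X) (OMap G X)"
    and naturality: "\<lbrakk>X \<in> Obj C; Y \<in> Obj C; f \<in> Hom C X Y\<rbrakk>
      \<Longrightarrow> Comp D (OMap F X) (OMap F Y) (OMap G Y) (\<tau> Y) (AMap F X Y f) =
          Comp D (OMap F X) (OMap G X) (OMap G Y) (AMap G X Y f) (\<tau> X)"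

definition id_func :: "('o, 'a, 'o, 'a) func" where
  "id_func = \<lparr>OMap = (\<lambda>X. X), AMap = (\<lambda>X Y f. f)\<rparr>"

definition comp_func ::
  "('p, 'b, 'q, 'c) func \<Rightarrow> ('o, 'a, 'p, 'b) func \<Rightarrow> ('o, 'a, 'q, 'c) func" where
  "comp_func G F = \<lparr>OMap = (\<lambda>X. OMap G (OMap F X)),
     AMap = (\<lambda>X Y f. AMap G (OMap F X) (OMap F Y) (AMap F X Y f))\<rparr>"

definition const_func :: "('p, 'b) cat \<Rightarrow> 'p \<Rightarrow> ('o, 'a, 'p, 'b) func" where
  "const_func D d = \<lparr>OMap = (\<lambda>_. d), AMap = (\<lambda>_ _ _. Id D d)\<rparr>"

definition fully_faithful ::
  "('o, 'a) cat \<Rightarrow> ('p, 'b) cat \<Rightarrow> ('o, 'a, 'p, 'b) func \<Rightarrow> bool" where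
  "fully_faithful C D F \<longleftrightarrow> is_functor C D F \<and>
     (\<forall>X\<in>Obj C. \<forall>Y\<in>Obj C. bij_betw (AMap F X Y) (Hom C X Y) (Hom D (OMap F X) (OMap F Y)))"

definition isomorphic :: "('o, 'a) cat \<Rightarrow> 'o \<Rightarrow> 'o \<Rightarrow> bool" where
  "isomorphic C X Y \<longleftrightarrow> (\<exists>f\<in>Hom C X Y. \<exists>g\<in>Hom C Y X.
     Comp C X Y X g f = Id C X \<and> Comp C Y X Y f g = Id C Y)"

text \<open>Local smallness is relative to the universe given by the type of the arrows.\<close>

definition locally_small :: "('o, 'u) cat \<Rightarrow> bool" where
  "locally_small C \<longleftrightarrow> (\<forall>X\<in>Obj C. \<forall>Y\<in>Obj C. small TYPE('u) (Hom C X Y))"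

definition op_cat :: "('o, 'a) cat \<Rightarrow> ('o, 'a) cat" where
  "op_cat C = \<lparr>Obj = Obj C, Hom = (\<lambda>X Y. Hom C Y X), Id = Id C,
     Comp = (\<lambda>X Y Z g f. Comp C Z Y X f g)\<rparr>"

definition full_sub :: "('o, 'a) cat \<Rightarrow> 'o set \<Rightarrow> ('o, 'a) cat" where
  "full_sub C \<A> = C\<lparr>Obj := \<A>\<rparr>"

definition slice :: "('o, 'a) cat \<Rightarrow> 'o \<Rightarrow> ('o \<times> 'a, 'a) cat" where
  "slice C X = \<lparr>Obj = {(A, a). A \<in> Obj C \<and> a \<in> Hom C A X},
     Hom = (\<lambda>(A, a) (B, b). {f \<in> Hom C A B. Comp C A B X b f = a}),
     Id = (\<lambda>(A, a). Id C A),
     Comp = (\<lambda>(A, _) (B, _) (D, _). Comp C A B D)\<rparr>"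

definition set_cat :: "('u set, 'u \<Rightarrow> 'u) cat" where
  "set_cat = \<lparr>Obj = {X. small TYPE('u) X}, Hom = (\<lambda>X Y. X \<rightarrow>\<^sub>E Y), Id = (\<lambda>X. \<lambda>x\<in>X. x),
     Comp = (\<lambda>X Y Z g f. compose X g f)\<rparr>"

text \<open>Families of components are made extensional so that equality of arrows in a functor
  category is equality of natural transformations.\<close>

definition functor_cat ::
  "('o, 'a) cat \<Rightarrow> ('p, 'b) cat \<Rightarrow> (('o, 'a, 'p, 'b) func, 'o \<Rightarrow> 'b) cat" where
  "functor_cat C D = \<lparr>Obj = {F. is_functor C D F},
     Hom = (\<lambda>F G. {\<tau> \<in> extensional (Obj C). nat_trans C D F G \<tau>}),
     Id = (\<lambda>F. \<lambda>X\<in>Obj C. Id D (OMap F X)),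
     Comp = (\<lambda>F G H \<sigma> \<tau>. \<lambda>X\<in>Obj C. Comp D (OMap F X) (OMap G X) (OMap H X) (\<sigma> X) (\<tau> X))\<rparr>"

definition presheaf_cat ::
  "('o, 'u) cat \<Rightarrow> (('o, 'u, 'u set, 'u \<Rightarrow> 'u) func, 'o \<Rightarrow> 'u \<Rightarrow> 'u) cat" where
  "presheaf_cat C = functor_cat (op_cat C) set_cat"


section \<open>Limits, colimits, adjoints\<close>

text \<open>\<open>J\<close> is the shape, \<open>D\<close> the diagram, \<open>c\<close> the vertex.\<close>

definition cone ::
  "('j, 'k) cat \<Rightarrow> ('o, 'a) cat \<Rightarrow> ('j, 'k, 'o, 'a) func \<Rightarrow> 'o \<Rightarrow> ('j \<Rightarrow> 'a) \<Rightarrow> bool" where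
  "cone J C D c \<tau> \<longleftrightarrow> c \<in> Obj C \<and> nat_trans J C (const_func C c) D \<tau>"

definition limit_cone ::
  "('j, 'k) cat \<Rightarrow> ('o, 'a) cat \<Rightarrow> ('j, 'k, 'o, 'a) func \<Rightarrow> 'o \<Rightarrow> ('j \<Rightarrow> 'a) \<Rightarrow> bool" where
  "limit_cone J C D c \<tau> \<longleftrightarrow> cone J C D c \<tau> \<and>
     (\<forall>d \<sigma>. cone J C D d \<sigma> \<longrightarrow>
       (\<exists>!h. h \<in> Hom C d c \<and> (\<forall>j\<in>Obj J. Comp C d c (OMap D j) (\<tau> j) h = \<sigma> j)))"

definition cocone ::
  "('j, 'k) cat \<Rightarrow> ('o, 'a) cat \<Rightarrow> ('j, 'k, 'o, 'a) func \<Rightarrow> 'o \<Rightarrow> ('j \<Rightarrow> 'a) \<Rightarrow> bool" where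
  "cocone J C D c \<tau> \<longleftrightarrow> c \<in> Obj C \<and> nat_trans J C D (const_func C c) \<tau>"

definition colimit_cocone ::
  "('j, 'k) cat \<Rightarrow> ('o, 'a) cat \<Rightarrow> ('j, 'k, 'o, 'a) func \<Rightarrow> 'o \<Rightarrow> ('j \<Rightarrow> 'a) \<Rightarrow> bool" where
  "colimit_cocone J C D c \<tau> \<longleftrightarrow> cocone J C D c \<tau> \<and>
     (\<forall>d \<sigma>. cocone J C D d \<sigma> \<longrightarrow>
       (\<exists>!h. h \<in> Hom C c d \<and> (\<forall>j\<in>Obj J. Comp C (OMap D j) c d h (\<tau> j) = \<sigma> j)))"

text \<open>Every finite category is isomorphic to one whose objects and arrows are natural numbers, so
  it is enough to take limits of diagrams of these shapes.\<close>

definition finite_category :: "(nat, nat) cat \<Rightarrow> bool" where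
  "finite_category J \<longleftrightarrow> category J \<and> finite (Obj J) \<and>
     (\<forall>i\<in>Obj J. \<forall>j\<in>Obj J. finite (Hom J i j))"

definition finitely_complete :: "('o, 'a) cat \<Rightarrow> bool" where
  "finitely_complete C \<longleftrightarrow>
     (\<forall>J D. finite_category J \<and> is_functor J C D \<longrightarrow> (\<exists>c \<tau>. limit_cone J C D c \<tau>))"

text \<open>The square with \<open>p : P \<rightarrow> A\<close>, \<open>q : P \<rightarrow> B\<close>, \<open>f : A \<rightarrow> Z\<close>, \<open>g : B \<rightarrow> Z\<close> is a pullback.\<close>

definition is_pullback ::
  "('o, 'a) cat \<Rightarrow> 'o \<Rightarrow> 'o \<Rightarrow> 'o \<Rightarrow> 'o \<Rightarrow> 'a \<Rightarrow> 'a \<Rightarrow> 'a \<Rightarrow> 'a \<Rightarrow> bool" where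
  "is_pullback C P A B Z p q f g \<longleftrightarrow>
     P \<in> Obj C \<and> A \<in> Obj C \<and> B \<in> Obj C \<and> Z \<in> Obj C \<and>
     p \<in> Hom C P A \<and> q \<in> Hom C P B \<and> f \<in> Hom C A Z \<and> g \<in> Hom C B Z \<and>
     Comp C P A Z f p = Comp C P B Z g q \<and>
     (\<forall>W\<in>Obj C. \<forall>a\<in>Hom C W A. \<forall>b\<in>Hom C W B. Comp C W A Z f a = Comp C W B Z g b \<longrightarrow>
       (\<exists>!h. h \<in> Hom C W P \<and> Comp C W P A p h = a \<and> Comp C W P B q h = b))"

definition preserves_pullbacks ::
  "('o, 'a) cat \<Rightarrow> ('p, 'b) cat \<Rightarrow> ('o, 'a, 'p, 'b) func \<Rightarrow> bool" where
  "preserves_pullbacks C D F \<longleftrightarrow> (\<forall>P A B Z p q f g. is_pullback C P A B Z p q f g \<longrightarrow>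
     is_pullback D (OMap F P) (OMap F A) (OMap F B) (OMap F Z)
       (AMap F P A p) (AMap F P B q) (AMap F A Z f) (AMap F B Z g))"

definition cartesian_nat_trans :: "('o, 'a) cat \<Rightarrow> ('p, 'b) cat \<Rightarrow>
    ('o, 'a, 'p, 'b) func \<Rightarrow> ('o, 'a, 'p, 'b) func \<Rightarrow> ('o \<Rightarrow> 'b) \<Rightarrow> bool" where
  "cartesian_nat_trans C D F G \<tau> \<longleftrightarrow> nat_trans C D F G \<tau> \<and>
     (\<forall>X\<in>Obj C. \<forall>Y\<in>Obj C. \<forall>f\<in>Hom C X Y.
       is_pullback D (OMap F X) (OMap F Y) (OMap G X) (OMap G Y)
         (AMap F X Y f) (\<tau> X) (\<tau> Y) (AMap G X Y f))"

text \<open>\<open>L\<close> is left adjoint to \<open>G\<close> by bijections \<open>\<Phi> d c : C(L d, c) \<rightarrow> D(d, G c)\<close> natural in both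
  variables.\<close>

definition adjunction :: "('o, 'a) cat \<Rightarrow> ('p, 'b) cat \<Rightarrow>
    ('p, 'b, 'o, 'a) func \<Rightarrow> ('o, 'a, 'p, 'b) func \<Rightarrow> ('p \<Rightarrow> 'o \<Rightarrow> 'a \<Rightarrow> 'b) \<Rightarrow> bool" where
  "adjunction C D L G \<Phi> \<longleftrightarrow> is_functor D C L \<and> is_functor C D G \<and>
     (\<forall>d\<in>Obj D. \<forall>c\<in>Obj C. bij_betw (\<Phi> d c) (Hom C (OMap L d) c) (Hom D d (OMap G c))) \<and>
     (\<forall>d\<in>Obj D. \<forall>c\<in>Obj C. \<forall>c'\<in>Obj C. \<forall>f\<in>Hom C (OMap L d) c. \<forall>k\<in>Hom C c c'.
       \<Phi> d c' (Comp C (OMap L d) c c' k f) =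
       Comp D d (OMap G c) (OMap G c') (AMap G c c' k) (\<Phi> d c f)) \<and>
     (\<forall>d\<in>Obj D. \<forall>d'\<in>Obj D. \<forall>c\<in>Obj C. \<forall>f\<in>Hom C (OMap L d) c. \<forall>h\<in>Hom D d' d.
       \<Phi> d' c (Comp C (OMap L d') (OMap L d) c f (AMap L d' d h)) =
       Comp D d' d (OMap G c) (\<Phi> d c f) h)"

definition has_left_adjoint ::
  "('o, 'a) cat \<Rightarrow> ('p, 'b) cat \<Rightarrow> ('o, 'a, 'p, 'b) func \<Rightarrow> bool" where
  "has_left_adjoint C D G \<longleftrightarrow> (\<exists>L \<Phi>. adjunction C D L G \<Phi>)"

definition slice_func ::
  "('o, 'a, 'p, 'b) func \<Rightarrow> 'o \<Rightarrow> ('o \<times> 'a, 'a, 'p \<times> 'b, 'b) func" where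
  "slice_func R X = \<lparr>OMap = (\<lambda>(A, a). (OMap R A, AMap R A X a)),
     AMap = (\<lambda>(A, _) (B, _) f. AMap R A B f)\<rparr>"

definition local_right_adjoint ::
  "('o, 'a) cat \<Rightarrow> ('p, 'b) cat \<Rightarrow> ('o, 'a, 'p, 'b) func \<Rightarrow> bool" where
  "local_right_adjoint C D R \<longleftrightarrow> is_functor C D R \<and>
     (\<forall>X\<in>Obj C. has_left_adjoint (slice C X) (slice D (OMap R X)) (slice_func R X))"


section \<open>Monads\<close>

record ('o, 'a) monad =
  Endo :: "('o, 'a, 'o, 'a) func"
  Unit :: "'o \<Rightarrow> 'a"
  Mult :: "'o \<Rightarrow> 'a"

abbreviation EO :: "('o, 'a) monad \<Rightarrow> 'o \<Rightarrow> 'o" where "EO T \<equiv> OMap (Endo T)"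
abbreviation EA :: "('o, 'a) monad \<Rightarrow> 'o \<Rightarrow> 'o \<Rightarrow> 'a \<Rightarrow> 'a" where "EA T \<equiv> AMap (Endo T)"

locale is_monad = category E for E :: "('o, 'a) cat" +
  fixes T :: "('o, 'a) monad"
  assumes unit_nat_trans: "nat_trans E E id_func (Endo T) (Unit T)"
    and mult_nat_trans: "nat_trans E E (comp_func (Endo T) (Endo T)) (Endo T) (Mult T)"
    and mult_assoc: "X \<in> Obj E \<Longrightarrow>
      Comp E (EO T (EO T (EO T X))) (EO T (EO T X)) (EO T X)
        (Mult T X) (EA T (EO T (EO T X)) (EO T X) (Mult T X)) =
      Comp E (EO T (EO T (EO T X))) (EO T (EO T X)) (EO T X)
        (Mult T X) (Mult T (EO T X))"
    and mult_unit: "X \<in> Obj E \<Longrightarrow>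
      Comp E (EO T X) (EO T (EO T X)) (EO T X) (Mult T X) (Unit T (EO T X)) = Id E (EO T X)"
    and mult_map_unit: "X \<in> Obj E \<Longrightarrow>
      Comp E (EO T X) (EO T (EO T X)) (EO T X) (Mult T X) (EA T X (EO T X) (Unit T X)) =
      Id E (EO T X)"

definition monad_morphism ::
  "('o, 'a) cat \<Rightarrow> ('o, 'a) monad \<Rightarrow> ('o, 'a) monad \<Rightarrow> ('o \<Rightarrow> 'a) \<Rightarrow> bool" where
  "monad_morphism E S T \<phi> \<longleftrightarrow> is_monad E S \<and> is_monad E T \<and>
     nat_trans E E (Endo S) (Endo T) \<phi> \<and>
     (\<forall>X\<in>Obj E. Comp E X (EO S X) (EO T X) (\<phi> X) (Unit S X) = Unit T X) \<and>
     (\<forall>X\<in>Obj E.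
       Comp E (EO S (EO S X)) (EO S X) (EO T X) (\<phi> X) (Mult S X) =
       Comp E (EO S (EO S X)) (EO T (EO T X)) (EO T X) (Mult T X)
         (Comp E (EO S (EO S X)) (EO T (EO S X)) (EO T (EO T X))
           (EA T (EO S X) (EO T X) (\<phi> X)) (\<phi> (EO S X))))"

definition cartesian_monad :: "('o, 'a) cat \<Rightarrow> ('o, 'a) monad \<Rightarrow> bool" where
  "cartesian_monad E T \<longleftrightarrow> is_monad E T \<and> preserves_pullbacks E E (Endo T) \<and>
     cartesian_nat_trans E E id_func (Endo T) (Unit T) \<and>
     cartesian_nat_trans E E (comp_func (Endo T) (Endo T)) (Endo T) (Mult T)"

definition strongly_cartesian_monad :: "('o, 'a) cat \<Rightarrow> ('o, 'a) monad \<Rightarrow> bool" where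
  "strongly_cartesian_monad E T \<longleftrightarrow> cartesian_monad E T \<and> local_right_adjoint E E (Endo T)"

text \<open>A monad over \<open>T\<close> is a monad \<open>S\<close> together with the morphism \<open>\<phi> : S \<Rightarrow> T\<close>.\<close>

definition cartesian_monad_over ::
  "('o, 'a) cat \<Rightarrow> ('o, 'a) monad \<Rightarrow> ('o, 'a) monad \<Rightarrow> ('o \<Rightarrow> 'a) \<Rightarrow> bool" where
  "cartesian_monad_over E T S \<phi> \<longleftrightarrow>
     monad_morphism E S T \<phi> \<and> cartesian_nat_trans E E (Endo S) (Endo T) \<phi>"


section \<open>Dense generators and arities\<close>

text \<open>A full subcategory is given by its set of objects.\<close>

definition nerve_obj ::
  "('o, 'u) cat \<Rightarrow> 'o \<Rightarrow> ('o, 'u, 'u set, 'u \<Rightarrow> 'u) func" where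
  "nerve_obj E X = \<lparr>OMap = (\<lambda>A. Hom E A X),
     AMap = (\<lambda>A B f. \<lambda>x\<in>Hom E A X. Comp E B A X x f)\<rparr>"

definition nerve :: "('o, 'u) cat \<Rightarrow> 'o set \<Rightarrow>
    ('o, 'u, ('o, 'u, 'u set, 'u \<Rightarrow> 'u) func, 'o \<Rightarrow> 'u \<Rightarrow> 'u) func" where
  "nerve E \<A> = \<lparr>OMap = nerve_obj E,
     AMap = (\<lambda>X Y g. \<lambda>A\<in>\<A>. \<lambda>x\<in>Hom E A X. Comp E A X Y g x)\<rparr>"

definition dense_generator :: "('o, 'u) cat \<Rightarrow> 'o set \<Rightarrow> bool" where
  "dense_generator E \<A> \<longleftrightarrow> \<A> \<subseteq> Obj E \<and> small TYPE('u) \<A> \<and>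
     fully_faithful E (presheaf_cat (full_sub E \<A>)) (nerve E \<A>)"

definition over_cat :: "('o, 'a) cat \<Rightarrow> 'o set \<Rightarrow> 'o \<Rightarrow> ('o \<times> 'a, 'a) cat" where
  "over_cat E \<A> X = full_sub (slice E X) {(A, a). A \<in> \<A> \<and> a \<in> Hom E A X}"

definition over_proj :: "('o \<times> 'a, 'a, 'o, 'a) func" where
  "over_proj = \<lparr>OMap = fst, AMap = (\<lambda>_ _ f. f)\<rparr>"

text \<open>The component at \<open>a : A \<rightarrow> X\<close> of the \<open>\<A>\<close>-cocone over \<open>X\<close>, whose diagram is
  \<^const>\<open>over_proj\<close>, is \<open>a\<close> itself.\<close>

definition canonical_cocone :: "'o \<times> 'a \<Rightarrow> 'a" where
  "canonical_cocone = snd"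

definition has_arities :: "('o, 'u) cat \<Rightarrow> ('o, 'u) monad \<Rightarrow> 'o set \<Rightarrow> bool" where
  "has_arities E S \<A> \<longleftrightarrow> (\<forall>X\<in>Obj E.
     let F = comp_func (nerve E \<A>) (Endo S) in
     colimit_cocone (over_cat E \<A> X) (presheaf_cat (full_sub E \<A>))
       (comp_func F over_proj) (OMap F X)
       (\<lambda>j. AMap F (OMap over_proj j) X (canonical_cocone j)))"


section \<open>Generic morphisms\<close>

definition generic :: "('o, 'a) cat \<Rightarrow> ('o, 'a) monad \<Rightarrow> 'o \<Rightarrow> 'o \<Rightarrow> 'a \<Rightarrow> bool" where
  "generic E T B A g \<longleftrightarrow> B \<in> Obj E \<and> A \<in> Obj E \<and> g \<in> Hom E B (EO T A) \<and>
     (\<forall>A'\<in>Obj E. \<forall>X\<in>Obj E. \<forall>\<alpha>\<in>Hom E B (EO T A'). \<forall>\<beta>\<in>Hom E A X. \<forall>\<gamma>\<in>Hom E A' X.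
       Comp E B (EO T A') (EO T X) (EA T A' X \<gamma>) \<alpha> = Comp E B (EO T A) (EO T X) (EA T A X \<beta>) g \<longrightarrow>
       (\<exists>!\<delta>. \<delta> \<in> Hom E A A' \<and> Comp E B (EO T A) (EO T A') (EA T A A' \<delta>) g = \<alpha> \<and>
          Comp E A A' X \<gamma> \<delta> = \<beta>))"

definition generically_closed :: "('o, 'a) cat \<Rightarrow> ('o, 'a) monad \<Rightarrow> 'o set \<Rightarrow> bool" where
  "generically_closed E T \<A> \<longleftrightarrow>
     (\<forall>B\<in>\<A>. \<forall>A\<in>Obj E. \<forall>g. generic E T B A g \<longrightarrow> (\<exists>A'\<in>\<A>. isomorphic E A A'))"

text \<open>\<open>\<A>\<^sub>T\<close> is least, up to isomorphism of objects, among the generically closed dense generators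
  containing \<open>\<A>\<close>; in particular none of these is properly smaller.\<close>

definition least_closed_dense_generator ::
  "('o, 'u) cat \<Rightarrow> ('o, 'u) monad \<Rightarrow> 'o set \<Rightarrow> 'o set \<Rightarrow> bool" where
  "least_closed_dense_generator E T \<A> \<A>\<^sub>T \<longleftrightarrow>
     \<A> \<subseteq> \<A>\<^sub>T \<and> dense_generator E \<A>\<^sub>T \<and> generically_closed E T \<A>\<^sub>T \<and>
     (\<forall>\<B>. \<A> \<subseteq> \<B> \<and> dense_generator E \<B> \<and> generically_closed E T \<B> \<longrightarrow>
       (\<forall>A\<in>\<A>\<^sub>T. \<exists>B\<in>\<B>. isomorphic E A B))"

end

theory Submission
  imports Defs
begin

text \<open>
  Let \<open>T\<close> be a strongly cartesian monad. The left adjoint of \<open>E/X \<rightarrow> E/T X\<close> factors every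
  \<open>h : B \<rightarrow> T X\<close> as a morphism \<open>g : B \<rightarrow> T A\<close> followed by \<open>T a\<close> for some \<open>a : A \<rightarrow> X\<close>, and since \<open>T\<close>
  preserves pullbacks \<open>g\<close> is generic (\<open>local_right_adjoint_generic_factorisation\<close>). Such a
  factorisation is unique up to isomorphism (\<open>generic_unique\<close>).

  \<open>\<A>\<^sub>T\<close> consists of \<open>\<A>\<close> and, for each arrow \<open>B \<rightarrow> T I\<close> with \<open>B\<close> in \<open>\<A>\<close> and \<open>I\<close> terminal, the codomain \<open>A\<close>
  of one generic part \<open>B \<rightarrow> T A\<close>. By uniqueness these are, up to isomorphism, all codomains of
  generic morphisms out of \<open>\<A>\<close>; there is only a small set of them because \<open>\<A>\<close> and the hom-sets are
  small and the universe is regular. Every generically closed \<open>\<B> \<supseteq> \<A>\<close> contains them up to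
  isomorphism, which gives minimality. Generic morphisms \<open>B \<rightarrow> T D\<close> and \<open>D \<rightarrow> T A\<close> compose to a
  generic \<open>B \<rightarrow> T A\<close> because the multiplication is cartesian (\<open>generic_Mult\<close>), so a single step
  already produces a generically closed set. It is a dense generator, as is every small set of
  objects containing a dense generator (\<open>dense_generator_mono\<close>).

  If \<open>\<phi> : S \<Rightarrow> T\<close> is cartesian, then generic factorisations for \<open>T\<close> lift along the naturality squares
  of \<open>\<phi>\<close> to generic factorisations for \<open>S\<close> (\<open>generic_factorisation_over\<close>). So every \<open>h : B \<rightarrow> S X\<close> with
  \<open>B\<close> in \<open>\<A>\<^sub>T\<close> has an \<open>S\<close>-generic factorisation through \<open>S A\<close> for some \<open>A\<close> in \<open>\<A>\<^sub>T\<close>. It is initial among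
  all factorisations \<open>h = S a \<circ> g\<close> with \<open>a\<close> in \<open>\<A>\<^sub>T/X\<close>, generic or not, and therefore \<open>E(B, S X)\<close> is the colimit of the sets
  \<open>E(B, S A)\<close> over \<open>\<A>\<^sub>T/X\<close>; this is the condition on arities
  (\<open>has_arities_if_generic_factorisation\<close>).
\<close>

section \<open>Functor categories, slices and the nerve\<close>

lemma set_cat_simps [simp]:
  "Obj set_cat = {X :: 'u set. small TYPE('u) X}"
  "Hom set_cat X Y = X \<rightarrow>\<^sub>E Y"
  "Id set_cat X = (\<lambda>x\<in>X. x)"
  "Comp set_cat X Y Z g f = compose X g f"
  by (simp_all add: set_cat_def)

lemma op_cat_simps [simp]:
  "Obj (op_cat C) = Obj C" "Hom (op_cat C) X Y = Hom C Y X" "Id (op_cat C) = Id C"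
  "Comp (op_cat C) X Y Z g f = Comp C Z Y X f g"
  by (simp_all add: op_cat_def)

lemma full_sub_simps [simp]:
  "Obj (full_sub C \<A>) = \<A>" "Hom (full_sub C \<A>) = Hom C" "Id (full_sub C \<A>) = Id C"
  "Comp (full_sub C \<A>) = Comp C"
  by (simp_all add: full_sub_def)

lemma functor_cat_simps [simp]:
  "Obj (functor_cat C D) = {F. is_functor C D F}"
  "Hom (functor_cat C D) F G = {\<tau> \<in> extensional (Obj C). nat_trans C D F G \<tau>}"
  "Id (functor_cat C D) F = (\<lambda>X\<in>Obj C. Id D (OMap F X))"
  "Comp (functor_cat C D) F G H \<sigma> \<tau> =
     (\<lambda>X\<in>Obj C. Comp D (OMap F X) (OMap G X) (OMap H X) (\<sigma> X) (\<tau> X))"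
  by (simp_all add: functor_cat_def)

lemma slice_simps [simp]:
  "Obj (slice C X) = {(A, a). A \<in> Obj C \<and> a \<in> Hom C A X}"
  "Hom (slice C X) (A, a) (B, b) = {f \<in> Hom C A B. Comp C A B X b f = a}"
  "Id (slice C X) (A, a) = Id C A"
  "Comp (slice C X) (A, a) (B, b) (D, d) = Comp C A B D"
  by (simp_all add: slice_def)

lemma func_simps [simp]:
  "OMap id_func X = X" "AMap id_func X Y f = f"
  "OMap (comp_func G F) Z = OMap G (OMap F Z)"
  "AMap (comp_func G F) Z W h = AMap G (OMap F Z) (OMap F W) (AMap F Z W h)"
  "OMap (const_func D d) j = d" "AMap (const_func D d) j k m = Id D d"
  "OMap over_proj p = fst p" "AMap over_proj p q = (\<lambda>f. f)"
  "OMap (slice_func R V) (A, a) = (OMap R A, AMap R A V a)"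
  "AMap (slice_func R V) (A, a) (B, b) n = AMap R A B n"
  by (simp_all add: id_func_def comp_func_def const_func_def over_proj_def slice_func_def)

lemma nerve_simps [simp]:
  "OMap (nerve E \<A>) X = nerve_obj E X"
  "AMap (nerve E \<A>) X Y g = (\<lambda>A\<in>\<A>. \<lambda>x\<in>Hom E A X. Comp E A X Y g x)"
  "OMap (nerve_obj E X) A = Hom E A X"
  "AMap (nerve_obj E X) A B f = (\<lambda>x\<in>Hom E A X. Comp E B A X x f)"
  by (simp_all add: nerve_def nerve_obj_def)

context category
begin

lemmas in_Hom [simp] = Id_in_Hom Comp_in_Hom
lemmas Comp_Id [simp] = Comp_Id_right Comp_Id_left

lemma category_op: "category (op_cat C)"
  by unfold_locales (simp_all add: Comp_assoc)

lemma category_full_sub: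
  assumes "\<A> \<subseteq> Obj C" shows "category (full_sub C \<A>)"
  using assms by unfold_locales (auto simp: subset_iff Comp_assoc)

lemma category_slice:
  assumes "X \<in> Obj C" shows "category (slice C X)"
  using assms by unfold_locales (auto simp: Comp_assoc split: prod.splits)

end

context is_functor
begin

lemmas map_in [simp] = OMap_in_Obj AMap_in_Hom

end

lemma category_set_cat: "category (set_cat :: ('u set, 'u \<Rightarrow> 'u) cat)"
proof
  fix X Y :: "'u set" and f :: "'u \<Rightarrow> 'u"
  assume f: "f \<in> Hom set_cat X Y"
  then show "Comp set_cat X X Y f (Id set_cat X) = f"
    by (auto simp: compose_def PiE_iff extensional_def fun_eq_iff)
  show "Comp set_cat X Y Y (Id set_cat Y) f = f"
    using f by (auto simp: compose_def PiE_iff extensional_def fun_eq_iff)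
next
  fix W X Y Z :: "'u set" and f g h
  assume "f \<in> Hom set_cat W X" "g \<in> Hom set_cat X Y" "h \<in> Hom set_cat Y Z"
  then show "Comp set_cat W Y Z h (Comp set_cat W X Y g f) =
      Comp set_cat W X Z (Comp set_cat X Y Z h g) f"
    by (auto simp: compose_def PiE_iff extensional_def fun_eq_iff)
qed (auto simp: compose_def PiE_iff)

lemma nat_transI:
  assumes "is_functor C D F" "is_functor C D G"
    and "\<And>X. X \<in> Obj C \<Longrightarrow> \<tau> X \<in> Hom D (OMap F X) (OMap G X)"
    and "\<And>X Y f. \<lbrakk>X \<in> Obj C; Y \<in> Obj C; f \<in> Hom C X Y\<rbrakk>
      \<Longrightarrow> Comp D (OMap F X) (OMap F Y) (OMap G Y) (\<tau> Y) (AMap F X Y f) =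
          Comp D (OMap F X) (OMap G X) (OMap G Y) (AMap G X Y f) (\<tau> X)"
  shows "nat_trans C D F G \<tau>"
  using assms by (simp add: nat_trans_def nat_trans_axioms_def)

lemma category_functor_cat:
  assumes "category C" and "category D" shows "category (functor_cat C D)"
proof -
  interpret C: category C by fact
  interpret D: category D by fact
  show ?thesis
  proof
    fix F assume "F \<in> Obj (functor_cat C D)"
    then interpret F: is_functor C D F by simp
    show "Id (functor_cat C D) F \<in> Hom (functor_cat C D) F F"
      by (auto intro!: nat_transI F.is_functor_axioms)
  next
    fix F G H \<tau> \<sigma>
    assume "\<tau> \<in> Hom (functor_cat C D) F G" "\<sigma> \<in> Hom (functor_cat C D) G H"
    then interpret t: nat_trans C D F G \<tau> + s: nat_trans C D G H \<sigma> by simp_all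
    show "Comp (functor_cat C D) F G H \<sigma> \<tau> \<in> Hom (functor_cat C D) F H"
      by (auto intro!: nat_transI t.F.is_functor_axioms s.G.is_functor_axioms
          simp: t.component_in_Hom s.component_in_Hom D.Comp_assoc s.naturality[symmetric])
        (simp add: t.component_in_Hom s.component_in_Hom D.Comp_assoc[symmetric] t.naturality)
  next
    fix F G \<tau> assume a: "\<tau> \<in> Hom (functor_cat C D) F G"
    then interpret t: nat_trans C D F G \<tau> by simp
    show "Comp (functor_cat C D) F F G \<tau> (Id (functor_cat C D) F) = \<tau>"
      "Comp (functor_cat C D) F G G (Id (functor_cat C D) G) \<tau> = \<tau>"
      using a by (auto simp: fun_eq_iff extensional_def t.component_in_Hom)
  next
    fix F G H K \<tau> \<sigma> \<rho>
    assume a: "\<tau> \<in> Hom (functor_cat C D) F G" "\<sigma> \<in> Hom (functor_cat C D) G H"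
      "\<rho> \<in> Hom (functor_cat C D) H K"
    then interpret t: nat_trans C D F G \<tau> + s: nat_trans C D G H \<sigma> + r: nat_trans C D H K \<rho>
      by simp_all
    show "Comp (functor_cat C D) F H K \<rho> (Comp (functor_cat C D) F G H \<sigma> \<tau>) =
        Comp (functor_cat C D) F G K (Comp (functor_cat C D) G H K \<rho> \<sigma>) \<tau>"
      by (auto simp: fun_eq_iff t.component_in_Hom s.component_in_Hom r.component_in_Hom
          D.Comp_assoc)
  qed
qed

lemma is_functor_comp:
  assumes "is_functor C D F" "is_functor D B G" shows "is_functor C B (comp_func G F)"
proof -
  interpret F: is_functor C D F by fact
  interpret G: is_functor D B G by fact
  show ?thesis by unfold_locales (simp_all add: F.AMap_Id F.AMap_Comp G.AMap_Id G.AMap_Comp)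
qed

lemma is_functor_const:
  assumes "category C" "category D" "d \<in> Obj D" shows "is_functor C D (const_func D d)"
proof -
  interpret C: category C by fact
  interpret D: category D by fact
  show ?thesis using assms(3) by unfold_locales simp_all
qed

context category
begin

lemma category_presheaf: "\<A> \<subseteq> Obj C \<Longrightarrow> category (functor_cat (op_cat (full_sub C \<A>)) set_cat)"
  by (intro category_functor_cat category_set_cat category.category_op category_full_sub)

end

locale locally_small_category = category E for E :: "('o, 'u) cat" +
  assumes Hom_small: "\<lbrakk>X \<in> Obj E; Y \<in> Obj E\<rbrakk> \<Longrightarrow> small TYPE('u) (Hom E X Y)"
begin

lemma is_functor_nerve_obj:
  assumes "\<A> \<subseteq> Obj E" "X \<in> Obj E"
  shows "is_functor (op_cat (full_sub E \<A>)) set_cat (nerve_obj E X)"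
proof -
  interpret P: category "op_cat (full_sub E \<A>)"
    using assms by (intro category.category_op category_full_sub)
  interpret S: category "set_cat :: ('u set, 'u \<Rightarrow> 'u) cat" by (rule category_set_cat)
  show ?thesis
    using assms by unfold_locales (auto simp: subset_iff Hom_small compose_def fun_eq_iff Comp_assoc)
qed

lemma nerve_map_nat_trans:
  assumes "\<A> \<subseteq> Obj E" "X \<in> Obj E" "Y \<in> Obj E" "f \<in> Hom E X Y"
  shows "nat_trans (op_cat (full_sub E \<A>)) set_cat (nerve_obj E X) (nerve_obj E Y)
    (\<lambda>A\<in>\<A>. \<lambda>x\<in>Hom E A X. Comp E A X Y f x)"
  using assms by (intro nat_transI is_functor_nerve_obj)
    (auto simp: subset_iff compose_def fun_eq_iff Comp_assoc)

lemma is_functor_nerve: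
  assumes "\<A> \<subseteq> Obj E"
  shows "is_functor E (presheaf_cat (full_sub E \<A>)) (nerve E \<A>)"
proof -
  interpret P: category "functor_cat (op_cat (full_sub E \<A>)) set_cat"
    using assms by (rule category_presheaf)
  show ?thesis unfolding presheaf_cat_def
    using assms by unfold_locales
      (auto simp: subset_iff is_functor_nerve_obj nerve_map_nat_trans compose_def fun_eq_iff Comp_assoc)
qed

end

lemma over_cat_simps [simp]:
  "Obj (over_cat E \<A> X) = {(A, a). A \<in> \<A> \<and> a \<in> Hom E A X}"
  "Hom (over_cat E \<A> X) (A, a) (B, b) = {f \<in> Hom E A B. Comp E A B X b f = a}"
  "Id (over_cat E \<A> X) (A, a) = Id E A"
  "Comp (over_cat E \<A> X) (A, a) (B, b) (D, d) = Comp E A B D"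
  by (simp_all add: over_cat_def)

context category
begin

lemma category_over:
  assumes "\<A> \<subseteq> Obj C" "X \<in> Obj C" shows "category (over_cat C \<A> X)"
  unfolding over_cat_def using assms
  by (intro category.category_full_sub category_slice) auto

lemma is_functor_over_proj:
  assumes "\<A> \<subseteq> Obj C" "X \<in> Obj C" shows "is_functor (over_cat C \<A> X) C over_proj"
proof -
  interpret O: category "over_cat C \<A> X" using assms by (rule category_over)
  show ?thesis using assms by unfold_locales (auto simp: subset_iff)
qed

end

section \<open>Pullbacks and terminal objects\<close>

context category
begin

text \<open>The shape \<open>0 \<rightarrow> 2 \<leftarrow> 1\<close>. Hom-sets need not be disjoint, so \<open>0\<close> serves as the only arrow of
  every nonempty one.\<close>

definition cospan_shape :: "(nat, nat) cat" where
  "cospan_shape = \<lparr>Obj = {0, 1, 2}, Hom = (\<lambda>i j. if i = j \<or> j = 2 then {0} else {}),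
     Id = (\<lambda>_. 0), Comp = (\<lambda>_ _ _ _ _. 0)\<rparr>"

text \<open>The diagram of shape \<^const>\<open>cospan_shape\<close> given by \<open>f : A \<rightarrow> Z\<close> and \<open>g : B \<rightarrow> Z\<close>.\<close>

definition cospan :: "'o \<Rightarrow> 'o \<Rightarrow> 'o \<Rightarrow> 'a \<Rightarrow> 'a \<Rightarrow> (nat, nat, 'o, 'a) func" where
  "cospan A B Z f g = \<lparr>OMap = (\<lambda>i. if i = 0 then A else if i = 1 then B else Z),
     AMap = (\<lambda>i j _. if i = 0 \<and> j = 0 then Id C A else if i = 1 \<and> j = 1 then Id C B
       else if i = 2 then Id C Z else if i = 0 then f else g)\<rparr>"

lemma finite_cospan_shape: "finite_category cospan_shape"
  unfolding finite_category_def
  by (auto simp: cospan_shape_def category_def split: if_splits)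

lemma ex_pullback:
  assumes "finitely_complete C" and "A \<in> Obj C" "B \<in> Obj C" "Z \<in> Obj C"
    and "f \<in> Hom C A Z" "g \<in> Hom C B Z"
  shows "\<exists>P p q. is_pullback C P A B Z p q f g"
proof -
  have F: "is_functor cospan_shape C (cospan A B Z f g)"
    using finite_cospan_shape category_axioms assms
    unfolding is_functor_def is_functor_axioms_def finite_category_def
    by (auto simp: cospan_shape_def cospan_def split: if_splits)
  from assms(1) F finite_cospan_shape obtain P \<tau>
    where lim: "limit_cone cospan_shape C (cospan A B Z f g) P \<tau>"
    unfolding finitely_complete_def by blast
  then have P: "P \<in> Obj C"
    and nt: "nat_trans cospan_shape C (const_func C P) (cospan A B Z f g) \<tau>"
    by (auto simp: limit_cone_def cone_def)
  interpret nat_trans cospan_shape C "const_func C P" "cospan A B Z f g" \<tau> by fact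
  have tau: "\<tau> 0 \<in> Hom C P A" "\<tau> 1 \<in> Hom C P B" "\<tau> 2 \<in> Hom C P Z"
    using component_in_Hom[of 0] component_in_Hom[of 1] component_in_Hom[of 2]
    by (simp_all add: cospan_shape_def cospan_def)
  have legs: "Comp C P A Z f (\<tau> 0) = \<tau> 2" "Comp C P B Z g (\<tau> 1) = \<tau> 2"
    using naturality[of 0 2 0] naturality[of 1 2 0] tau P assms
    by (simp_all add: cospan_shape_def cospan_def)
  have "\<exists>!h. h \<in> Hom C W P \<and> Comp C W P A (\<tau> 0) h = a \<and> Comp C W P B (\<tau> 1) h = b"
    if W: "W \<in> Obj C" "a \<in> Hom C W A" "b \<in> Hom C W B" "Comp C W A Z f a = Comp C W B Z g b"
    for W a b
  proof -
    define \<sigma> where "\<sigma> i = (if i = 0 then a else if i = 1 then b else Comp C W A Z f a)" for i :: nat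
    have K: "is_functor cospan_shape C (const_func C W)"
      using finite_cospan_shape category_axioms W
      by (intro is_functor_const) (auto simp: finite_category_def)
    have "nat_trans cospan_shape C (const_func C W) (cospan A B Z f g) \<sigma>"
    proof (rule nat_transI[OF K F])
      fix i j k assume "i \<in> Obj cospan_shape" "j \<in> Obj cospan_shape" "k \<in> Hom cospan_shape i j"
      then show "Comp C (OMap (const_func C W) i) (OMap (const_func C W) j) (OMap (cospan A B Z f g) j)
          (\<sigma> j) (AMap (const_func C W) i j k) =
        Comp C (OMap (const_func C W) i) (OMap (cospan A B Z f g) i) (OMap (cospan A B Z f g) j)
          (AMap (cospan A B Z f g) i j k) (\<sigma> i)"
        using W assms(2-)
        by (simp add: cospan_shape_def, elim disjE; simp add: cospan_def \<sigma>_def)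
    next
      fix i assume "i \<in> Obj cospan_shape"
      then show "\<sigma> i \<in> Hom C (OMap (const_func C W) i) (OMap (cospan A B Z f g) i)"
        using W assms(2-)
        by (simp add: cospan_shape_def, elim disjE; simp add: cospan_def \<sigma>_def)
    qed
    then have "cone cospan_shape C (cospan A B Z f g) W \<sigma>"
      unfolding cone_def using W by blast
    then have "\<exists>!h. h \<in> Hom C W P \<and>
        (\<forall>j\<in>Obj cospan_shape. Comp C W P (OMap (cospan A B Z f g) j) (\<tau> j) h = \<sigma> j)"
      using lim by (simp add: limit_cone_def)
    moreover have "(\<forall>j\<in>Obj cospan_shape. Comp C W P (OMap (cospan A B Z f g) j) (\<tau> j) h = \<sigma> j)
        \<longleftrightarrow> Comp C W P A (\<tau> 0) h = a \<and> Comp C W P B (\<tau> 1) h = b" if h: "h \<in> Hom C W P" for h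
    proof -
      have "Comp C W P Z (\<tau> 2) h = Comp C W A Z f (Comp C W P A (\<tau> 0) h)"
        using h W P tau assms by (simp add: Comp_assoc legs)
      then show ?thesis by (auto simp: cospan_shape_def cospan_def \<sigma>_def)
    qed
    ultimately show ?thesis by (simp cong: conj_cong)
  qed
  then have "is_pullback C P A B Z (\<tau> 0) (\<tau> 1) f g"
    unfolding is_pullback_def using P tau legs assms by simp
  then show ?thesis by blast
qed

lemma ex_terminal:
  assumes "finitely_complete C"
  shows "\<exists>I\<in>Obj C. \<forall>X\<in>Obj C. \<exists>!t. t \<in> Hom C X I"
proof -
  define J :: "(nat, nat) cat" where
    "J = \<lparr>Obj = {}, Hom = (\<lambda>_ _. {}), Id = (\<lambda>_. 0), Comp = (\<lambda>_ _ _ _ _. 0)\<rparr>"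
  have J: "finite_category J" and [simp]: "Obj J = {}"
    by (simp_all add: finite_category_def category_def J_def)
  have F: "is_functor J C F" for F
    using J category_axioms by (simp add: is_functor_def is_functor_axioms_def finite_category_def)
  have cone: "cone J C D X \<sigma>" if "X \<in> Obj C" for D X \<sigma>
    unfolding cone_def using that F by (auto intro!: nat_transI)
  from assms F J obtain I \<tau> where lim: "limit_cone J C undefined I \<tau>"
    unfolding finitely_complete_def by blast
  then have "I \<in> Obj C" by (simp add: limit_cone_def cone_def)
  moreover have "\<exists>!t. t \<in> Hom C X I" if "X \<in> Obj C" for X
    using lim cone[OF that] by (simp add: limit_cone_def)
  ultimately show ?thesis by blast
qed

lemma pullback_lift:
  assumes "is_pullback C P A B Z p q f g" "W \<in> Obj C" "a \<in> Hom C W A" "b \<in> Hom C W B"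
    and "Comp C W A Z f a = Comp C W B Z g b"
  obtains h where "h \<in> Hom C W P" "Comp C W P A p h = a" "Comp C W P B q h = b"
  using assms unfolding is_pullback_def by blast

lemma pullback_eqI:
  assumes "is_pullback C P A B Z p q f g" "W \<in> Obj C" "h \<in> Hom C W P" "h' \<in> Hom C W P"
    and "Comp C W P A p h = Comp C W P A p h'" "Comp C W P B q h = Comp C W P B q h'"
  shows "h = h'"
proof -
  have "Comp C W A Z f (Comp C W P A p h) = Comp C W B Z g (Comp C W P B q h)"
    using assms by (auto simp: is_pullback_def Comp_assoc)
  moreover have "Comp C W P A p h \<in> Hom C W A" "Comp C W P B q h \<in> Hom C W B"
    using assms by (auto simp: is_pullback_def)
  ultimately have "\<exists>!k. k \<in> Hom C W P \<and> Comp C W P A p k = Comp C W P A p h \<and>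
      Comp C W P B q k = Comp C W P B q h"
    using assms(1,2) unfolding is_pullback_def by blast
  with assms(3-) show ?thesis by metis
qed

lemma isomorphic_refl: "X \<in> Obj C \<Longrightarrow> isomorphic C X X"
  unfolding isomorphic_def using Id_in_Hom Comp_Id_left by blast

end

section \<open>Enlarging a dense generator\<close>

context locally_small_category
begin

text \<open>A natural transformation of nerves over \<open>\<B>\<close> restricts to one over \<open>\<A>\<close>, which comes from an arrow
  \<open>f\<close>; that \<open>f\<close> also induces it at the objects of \<open>\<B>\<close> may be tested on the objects of \<open>\<A>\<close>.\<close>

lemma dense_generator_mono:
  assumes dense: "dense_generator E \<A>" and sub: "\<A> \<subseteq> \<B>" "\<B> \<subseteq> Obj E" and sm: "small TYPE('u) \<B>"
  shows "dense_generator E \<B>"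
proof -
  let ?P = "presheaf_cat (full_sub E \<A>)" and ?Q = "presheaf_cat (full_sub E \<B>)"
  have A: "\<A> \<subseteq> Obj E" using sub by blast
  have bij: "bij_betw (AMap (nerve E \<A>) X Y) (Hom E X Y) (Hom ?P (nerve_obj E X) (nerve_obj E Y))"
    if "X \<in> Obj E" "Y \<in> Obj E" for X Y
    using dense that by (simp add: dense_generator_def fully_faithful_def)
  \<comment> \<open>Arrows out of \<open>X\<close> are separated by the arrows from objects of \<open>\<A>\<close>.\<close>
  have sep: "f = f'" if X: "X \<in> Obj E" "Y \<in> Obj E" "f \<in> Hom E X Y" "f' \<in> Hom E X Y"
    and eq: "\<And>A a. A \<in> \<A> \<Longrightarrow> a \<in> Hom E A X \<Longrightarrow> Comp E A X Y f a = Comp E A X Y f' a" for X Y f f'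
  proof -
    have "AMap (nerve E \<A>) X Y f = AMap (nerve E \<A>) X Y f'"
      by (auto simp: fun_eq_iff eq)
    with bij[OF X(1,2)] X(3,4) show ?thesis by (auto simp: bij_betw_def inj_on_def)
  qed
  have "bij_betw (AMap (nerve E \<B>) X Y) (Hom E X Y) (Hom ?Q (nerve_obj E X) (nerve_obj E Y))"
    if X: "X \<in> Obj E" "Y \<in> Obj E" for X Y
    unfolding bij_betw_def
  proof (intro conjI inj_onI equalityI subsetI)
    fix f f' assume f: "f \<in> Hom E X Y" "f' \<in> Hom E X Y"
      and eq: "AMap (nerve E \<B>) X Y f = AMap (nerve E \<B>) X Y f'"
    show "f = f'"
    proof (rule sep[OF X f])
      fix A a assume "A \<in> \<A>" "a \<in> Hom E A X"
      then show "Comp E A X Y f a = Comp E A X Y f' a"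
        using fun_cong[OF fun_cong[OF eq, of A], of a] sub by auto
    qed
  next
    fix \<tau> assume "\<tau> \<in> AMap (nerve E \<B>) X Y ` Hom E X Y"
    then show "\<tau> \<in> Hom ?Q (nerve_obj E X) (nerve_obj E Y)"
      using nerve_map_nat_trans[OF sub(2) X] by (auto simp: presheaf_cat_def)
  next
    fix \<tau> assume t: "\<tau> \<in> Hom ?Q (nerve_obj E X) (nerve_obj E Y)"
    then interpret t: nat_trans "op_cat (full_sub E \<B>)" set_cat "nerve_obj E X" "nerve_obj E Y" \<tau>
      by (simp add: presheaf_cat_def)
    have mem: "\<tau> B \<in> Hom E B X \<rightarrow>\<^sub>E Hom E B Y" if "B \<in> \<B>" for B
      using t.component_in_Hom that by simp
    have val: "\<tau> B b \<in> Hom E B Y" if "B \<in> \<B>" "b \<in> Hom E B X" for B b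
      using mem that by blast
    have nat: "\<tau> A (Comp E A B X b k) = Comp E A B Y (\<tau> B b) k"
      if "A \<in> \<B>" "B \<in> \<B>" "k \<in> Hom E A B" "b \<in> Hom E B X" for A B b k
      using fun_cong[OF t.naturality[of B A k], of b] that mem[of B] by (auto simp: compose_def)
    have "(\<lambda>A\<in>\<A>. \<tau> A) \<in> Hom ?P (nerve_obj E X) (nerve_obj E Y)"
      unfolding presheaf_cat_def using sub mem A X
      by (auto intro!: nat_transI is_functor_nerve_obj simp: compose_def fun_eq_iff nat val subset_iff)
    then obtain f where f: "f \<in> Hom E X Y" "(\<lambda>A\<in>\<A>. \<tau> A) = AMap (nerve E \<A>) X Y f"
      using bij[OF X] unfolding bij_betw_def by blast
    have fA: "\<tau> A a = Comp E A X Y f a" if "A \<in> \<A>" "a \<in> Hom E A X" for A a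
      using fun_cong[OF fun_cong[OF f(2), of A], of a] that by auto
    have "\<tau> B b = Comp E B X Y f b" if b: "B \<in> \<B>" "b \<in> Hom E B X" for B b
    proof (rule sep[of B Y])
      fix A a assume a: "A \<in> \<A>" "a \<in> Hom E A B"
      then have "Comp E A B Y (\<tau> B b) a = \<tau> A (Comp E A B X b a)"
        using nat[of A B a b] b sub by auto
      also have "\<dots> = Comp E A X Y f (Comp E A B X b a)"
        using fA a b sub X by (auto simp: subset_iff)
      finally show "Comp E A B Y (\<tau> B b) a = Comp E A B Y (Comp E B X Y f b) a"
        using a b sub X f by (auto simp: subset_iff Comp_assoc)
    qed (use b sub X f mem[of B] in auto)
    then have "\<tau> = AMap (nerve E \<B>) X Y f"
      using mem t by (auto simp: fun_eq_iff presheaf_cat_def extensional_def)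
    with f show "\<tau> \<in> AMap (nerve E \<B>) X Y ` Hom E X Y" by blast
  qed
  then show ?thesis
    using sub sm is_functor_nerve[OF sub(2)] by (simp add: dense_generator_def fully_faithful_def)
qed

end

lemma small_Sigma:
  assumes "small_universe TYPE('u)" "small TYPE('u) I" "\<And>i. i \<in> I \<Longrightarrow> small TYPE('u) (X i)"
  shows "small TYPE('u) (Sigma I X)"
proof -
  have "stable |UNIV :: 'u set|"
    using assms(1) regularCard_stable[OF card_of_Card_order]
    by (auto simp: small_universe_def Field_card_of)
  then show ?thesis using assms(2,3) unfolding small_def by (rule stable_elim)
qed

lemma small_image: "small TYPE('u) X \<Longrightarrow> small TYPE('u) (f ` X)"
  unfolding small_def using card_of_image ordLeq_ordLess_trans by blast

lemma small_Un:
  assumes "small_universe TYPE('u)" "small TYPE('u) X" "small TYPE('u) Y"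
  shows "small TYPE('u) (X \<union> Y)"
  using assms unfolding small_def small_universe_def by (intro card_of_Un_ordLess_infinite) auto

section \<open>Generic morphisms\<close>

text \<open>\<open>A\<close> with \<open>a : A \<rightarrow> X\<close> is the value at \<open>h : B \<rightarrow> R X\<close> of the left adjoint of \<open>C/X \<rightarrow> D/R X\<close>, and \<open>g\<close> is
  the unit of that adjunction. The universal property is only one over \<open>X\<close>, so that \<open>g\<close> is not yet
  shown to be generic.\<close>

lemma local_right_adjoint_factorisation:
  assumes "local_right_adjoint C D R" and X: "X \<in> Obj C" and B: "B \<in> Obj D"
    and h: "h \<in> Hom D B (OMap R X)"
  obtains A a g where "A \<in> Obj C" "a \<in> Hom C A X" "g \<in> Hom D B (OMap R A)"
    "Comp D B (OMap R A) (OMap R X) (AMap R A X a) g = h"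
    "\<And>A' \<gamma> \<alpha>. \<lbrakk>A' \<in> Obj C; \<gamma> \<in> Hom C A' X; \<alpha> \<in> Hom D B (OMap R A');
        Comp D B (OMap R A') (OMap R X) (AMap R A' X \<gamma>) \<alpha> = h\<rbrakk>
      \<Longrightarrow> \<exists>!\<delta>. \<delta> \<in> Hom C A A' \<and> Comp C A A' X \<gamma> \<delta> = a \<and>
        Comp D B (OMap R A) (OMap R A') (AMap R A A' \<delta>) g = \<alpha>"
proof -
  let ?C = "slice C X" and ?D = "slice D (OMap R X)" and ?R = "slice_func R X"
  obtain L \<Phi> where adj: "adjunction ?C ?D L ?R \<Phi>" and R: "is_functor C D R"
    using assms(1) X by (auto simp: local_right_adjoint_def has_left_adjoint_def)
  interpret R: is_functor C D R by fact
  interpret L: is_functor ?D ?C L using adj by (simp add: adjunction_def)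
  have bij: "\<And>d c. d \<in> Obj ?D \<Longrightarrow> c \<in> Obj ?C \<Longrightarrow>
      bij_betw (\<Phi> d c) (Hom ?C (OMap L d) c) (Hom ?D d (OMap ?R c))"
    and nat: "\<And>d c c' f k. d \<in> Obj ?D \<Longrightarrow> c \<in> Obj ?C \<Longrightarrow> c' \<in> Obj ?C \<Longrightarrow>
      f \<in> Hom ?C (OMap L d) c \<Longrightarrow> k \<in> Hom ?C c c' \<Longrightarrow>
      \<Phi> d c' (Comp ?C (OMap L d) c c' k f) =
      Comp ?D d (OMap ?R c) (OMap ?R c') (AMap ?R c c' k) (\<Phi> d c f)"
    using adj unfolding adjunction_def by blast+
  have d: "(B, h) \<in> Obj ?D" using B h by simp
  obtain A a where Aa: "OMap L (B, h) = (A, a)" by fastforce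
  with L.OMap_in_Obj[OF d] have c: "(A, a) \<in> Obj ?C" by simp
  then have A: "A \<in> Obj C" "a \<in> Hom C A X" by auto
  define g where "g = \<Phi> (B, h) (A, a) (Id C A)"
  have id: "Id C A \<in> Hom ?C (OMap L (B, h)) (A, a)" using A X by (simp add: Aa)
  then have "g \<in> Hom ?D (B, h) (OMap ?R (A, a))"
    unfolding g_def using bij[OF d c] by (auto simp: bij_betw_def)
  then have g: "g \<in> Hom D B (OMap R A)" "Comp D B (OMap R A) (OMap R X) (AMap R A X a) g = h"
    by simp_all
  have "\<exists>!\<delta>. \<delta> \<in> Hom C A A' \<and> Comp C A A' X \<gamma> \<delta> = a \<and>
        Comp D B (OMap R A) (OMap R A') (AMap R A A' \<delta>) g = \<alpha>"
    if A': "A' \<in> Obj C" "\<gamma> \<in> Hom C A' X" "\<alpha> \<in> Hom D B (OMap R A')"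
      "Comp D B (OMap R A') (OMap R X) (AMap R A' X \<gamma>) \<alpha> = h" for A' \<gamma> \<alpha>
  proof -
    have c': "(A', \<gamma>) \<in> Obj ?C" using A' by simp
    have \<Phi>: "\<Phi> (B, h) (A', \<gamma>) \<delta> = Comp D B (OMap R A) (OMap R A') (AMap R A A' \<delta>) g"
      if "\<delta> \<in> Hom ?C (A, a) (A', \<gamma>)" for \<delta>
      using nat[OF d c c' id, of \<delta>] that A A' by (simp add: Aa g_def)
    have "\<alpha> \<in> Hom ?D (B, h) (OMap ?R (A', \<gamma>))" using A' by simp
    then have "\<exists>!\<delta>. \<delta> \<in> Hom ?C (A, a) (A', \<gamma>) \<and> \<Phi> (B, h) (A', \<gamma>) \<delta> = \<alpha>"
      using bij[OF d c'] unfolding Aa bij_betw_def inj_on_def by (smt (verit, best) imageE)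
    then show ?thesis using \<Phi> by (auto cong: conj_cong)
  qed
  with A g that show ?thesis by blast
qed

context category
begin

lemma genericI:
  assumes "B \<in> Obj C" "A \<in> Obj C" "g \<in> Hom C B (EO T A)"
    and "\<And>A' X \<alpha> \<beta> \<gamma>. \<lbrakk>A' \<in> Obj C; X \<in> Obj C; \<alpha> \<in> Hom C B (EO T A'); \<beta> \<in> Hom C A X;
        \<gamma> \<in> Hom C A' X;
        Comp C B (EO T A') (EO T X) (EA T A' X \<gamma>) \<alpha> = Comp C B (EO T A) (EO T X) (EA T A X \<beta>) g\<rbrakk>
      \<Longrightarrow> \<exists>!\<delta>. \<delta> \<in> Hom C A A' \<and> Comp C B (EO T A) (EO T A') (EA T A A' \<delta>) g = \<alpha> \<and>
          Comp C A A' X \<gamma> \<delta> = \<beta>"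
  shows "generic C T B A g"
  using assms by (simp add: generic_def)

lemma genericD:
  assumes "generic C T B A g"
  shows "B \<in> Obj C" "A \<in> Obj C" "g \<in> Hom C B (EO T A)"
  using assms by (simp_all add: generic_def)

lemma generic_lift:
  assumes "generic C T B A g" "A' \<in> Obj C" "X \<in> Obj C" "\<alpha> \<in> Hom C B (EO T A')" "\<beta> \<in> Hom C A X"
    "\<gamma> \<in> Hom C A' X"
    "Comp C B (EO T A') (EO T X) (EA T A' X \<gamma>) \<alpha> = Comp C B (EO T A) (EO T X) (EA T A X \<beta>) g"
  obtains \<delta> where "\<delta> \<in> Hom C A A'" "Comp C B (EO T A) (EO T A') (EA T A A' \<delta>) g = \<alpha>"
    "Comp C A A' X \<gamma> \<delta> = \<beta>"
  using assms unfolding generic_def by blast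

end

text \<open>Only the endofunctor of \<open>T\<close> enters the definition of generic morphisms; no law of the unit
  or of the multiplication is assumed here.\<close>

locale monad_endofunctor = category E for E :: "('o, 'u) cat" +
  fixes T :: "('o, 'u) monad"
  assumes endo: "is_functor E E (Endo T)"
begin

sublocale T: is_functor E E "Endo T" by (rule endo)

lemma generic_eqI:
  assumes "generic E T B A g" "A' \<in> Obj E" "X \<in> Obj E" "\<gamma> \<in> Hom E A' X"
    "\<delta> \<in> Hom E A A'" "\<delta>' \<in> Hom E A A'"
    "Comp E B (EO T A) (EO T A') (EA T A A' \<delta>) g = Comp E B (EO T A) (EO T A') (EA T A A' \<delta>') g"
    "Comp E A A' X \<gamma> \<delta> = Comp E A A' X \<gamma> \<delta>'"
  shows "\<delta> = \<delta>'"
proof -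
  let ?\<alpha> = "Comp E B (EO T A) (EO T A') (EA T A A' \<delta>) g" and ?\<beta> = "Comp E A A' X \<gamma> \<delta>"
  note [simp] = genericD[OF assms(1)]
  have "Comp E B (EO T A') (EO T X) (EA T A' X \<gamma>) ?\<alpha> = Comp E B (EO T A) (EO T X) (EA T A X ?\<beta>) g"
    using assms by (simp add: T.AMap_Comp Comp_assoc)
  then have "\<exists>!\<delta>. \<delta> \<in> Hom E A A' \<and> Comp E B (EO T A) (EO T A') (EA T A A' \<delta>) g = ?\<alpha> \<and>
      Comp E A A' X \<gamma> \<delta> = ?\<beta>"
    using assms unfolding generic_def by (simp add: genericD)
  with assms(5-) show ?thesis by metis
qed

lemma generic_unique:
  assumes g: "generic E T B A g" and g': "generic E T B A' g'"
    and X: "X \<in> Obj E" "a \<in> Hom E A X" "a' \<in> Hom E A' X"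
    and eq: "Comp E B (EO T A) (EO T X) (EA T A X a) g = Comp E B (EO T A') (EO T X) (EA T A' X a') g'"
  shows "isomorphic E A A'"
proof -
  note [simp] = genericD[OF g] genericD[OF g']
  obtain \<delta> where d: "\<delta> \<in> Hom E A A'" "Comp E B (EO T A) (EO T A') (EA T A A' \<delta>) g = g'"
      "Comp E A A' X a' \<delta> = a"
    using generic_lift[OF g, of A' X g' a a'] X eq by auto
  obtain \<delta>' where d': "\<delta>' \<in> Hom E A' A" "Comp E B (EO T A') (EO T A) (EA T A' A \<delta>') g' = g"
      "Comp E A' A X a \<delta>' = a'"
    using generic_lift[OF g', of A X g a' a] X eq by auto
  have "Comp E A A' A \<delta>' \<delta> = Id E A"
    by (rule generic_eqI[OF g _ X(1,2)])
      (use d d' X in \<open>simp_all add: T.AMap_Comp T.AMap_Id Comp_assoc\<close>,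
        simp_all flip: Comp_assoc)
  moreover have "Comp E A' A A' \<delta> \<delta>' = Id E A'"
    by (rule generic_eqI[OF g' _ X(1,3)])
      (use d d' X in \<open>simp_all add: T.AMap_Comp T.AMap_Id Comp_assoc\<close>,
        simp_all flip: Comp_assoc)
  ultimately show ?thesis using d d' by (auto simp: isomorphic_def)
qed

end

context monad_endofunctor
begin

lemma generic_iso:
  assumes g: "generic E T B A g" and A': "A' \<in> Obj E" and i: "i \<in> Hom E A A'" "j \<in> Hom E A' A"
    "Comp E A A' A j i = Id E A" "Comp E A' A A' i j = Id E A'"
  shows "generic E T B A' (Comp E B (EO T A) (EO T A') (EA T A A' i) g)"
proof (rule genericI)
  note [simp] = genericD[OF g] A' i(1,2)
  show "Comp E B (EO T A) (EO T A') (EA T A A' i) g \<in> Hom E B (EO T A')" by simp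
  fix D X \<alpha> \<beta> \<gamma>
  assume [simp]: "D \<in> Obj E" "X \<in> Obj E" "\<alpha> \<in> Hom E B (EO T D)" "\<beta> \<in> Hom E A' X" "\<gamma> \<in> Hom E D X"
    and eq: "Comp E B (EO T D) (EO T X) (EA T D X \<gamma>) \<alpha> =
      Comp E B (EO T A') (EO T X) (EA T A' X \<beta>) (Comp E B (EO T A) (EO T A') (EA T A A' i) g)"
  have ij: "Comp E A' A Z (Comp E A A' Z f i) j = f" if "Z \<in> Obj E" "f \<in> Hom E A' Z" for Z f
    using that by (simp add: i(4) flip: Comp_assoc)
  have ji: "Comp E A A' Z (Comp E A' A Z f j) i = f" if "Z \<in> Obj E" "f \<in> Hom E A Z" for Z f
    using that by (simp add: i(3) flip: Comp_assoc)
  obtain \<delta> where d: "\<delta> \<in> Hom E A D" "Comp E B (EO T A) (EO T D) (EA T A D \<delta>) g = \<alpha>"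
      "Comp E A D X \<gamma> \<delta> = Comp E A A' X \<beta> i"
    by (rule generic_lift[OF g, of D X \<alpha> "Comp E A A' X \<beta> i" \<gamma>])
      (simp_all add: eq T.AMap_Comp Comp_assoc)
  show "\<exists>!\<epsilon>. \<epsilon> \<in> Hom E A' D \<and> Comp E B (EO T A') (EO T D) (EA T A' D \<epsilon>)
      (Comp E B (EO T A) (EO T A') (EA T A A' i) g) = \<alpha> \<and> Comp E A' D X \<gamma> \<epsilon> = \<beta>"
  proof (intro ex1I[of _ "Comp E A' A D \<delta> j"] conjI)
    show "Comp E A' A D \<delta> j \<in> Hom E A' D" using d by simp
    have "Comp E B (EO T A') (EO T D) (EA T A' D (Comp E A' A D \<delta> j))
        (Comp E B (EO T A) (EO T A') (EA T A A' i) g) =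
      Comp E B (EO T A) (EO T D) (EA T A D (Comp E A A' D (Comp E A' A D \<delta> j) i)) g"
      using d(1) by (simp add: T.AMap_Comp[of A A' D] Comp_assoc)
    then show "Comp E B (EO T A') (EO T D) (EA T A' D (Comp E A' A D \<delta> j))
        (Comp E B (EO T A) (EO T A') (EA T A A' i) g) = \<alpha>"
      using d by (simp add: ji)
    show "Comp E A' D X \<gamma> (Comp E A' A D \<delta> j) = \<beta>" using d by (simp add: Comp_assoc ij)
  next
    fix \<epsilon> assume e: "\<epsilon> \<in> Hom E A' D \<and> Comp E B (EO T A') (EO T D) (EA T A' D \<epsilon>)
      (Comp E B (EO T A) (EO T A') (EA T A A' i) g) = \<alpha> \<and> Comp E A' D X \<gamma> \<epsilon> = \<beta>"
    have "Comp E A A' D \<epsilon> i = \<delta>"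
      by (rule generic_eqI[OF g, of D X \<gamma>]) (use d e in \<open>auto simp: T.AMap_Comp Comp_assoc\<close>)
    then show "\<epsilon> = Comp E A' A D \<delta> j" using e ij by auto
  qed
qed (use A' genericD[OF g] in simp_all)

text \<open>The factorisation given by the left adjoint over \<open>X\<close> is generic: a lifting problem over another
  object \<open>Y\<close> along \<open>\<beta> : A \<rightarrow> Y\<close> is turned into one over \<open>A\<close>, hence over \<open>X\<close>, by pulling back along \<open>\<beta>\<close>,
  and \<open>T\<close> preserves this pullback.\<close>

lemma local_right_adjoint_generic_factorisation:
  assumes fc: "finitely_complete E" and lra: "local_right_adjoint E E (Endo T)"
    and pres: "preserves_pullbacks E E (Endo T)"
    and B: "B \<in> Obj E" and X: "X \<in> Obj E" and h: "h \<in> Hom E B (EO T X)"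
  obtains A a g where "generic E T B A g" "a \<in> Hom E A X"
    "Comp E B (EO T A) (EO T X) (EA T A X a) g = h"
proof -
  obtain A a g where A: "A \<in> Obj E" "a \<in> Hom E A X" and g: "g \<in> Hom E B (EO T A)"
    and fac: "Comp E B (EO T A) (EO T X) (EA T A X a) g = h"
    and univ: "\<And>A' \<gamma> \<alpha>. \<lbrakk>A' \<in> Obj E; \<gamma> \<in> Hom E A' X; \<alpha> \<in> Hom E B (EO T A');
        Comp E B (EO T A') (EO T X) (EA T A' X \<gamma>) \<alpha> = h\<rbrakk>
      \<Longrightarrow> \<exists>!\<delta>. \<delta> \<in> Hom E A A' \<and> Comp E A A' X \<gamma> \<delta> = a \<and>
        Comp E B (EO T A) (EO T A') (EA T A A' \<delta>) g = \<alpha>"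
    using local_right_adjoint_factorisation[OF lra X B h] by metis
  note [simp] = A g B X
  have "generic E T B A g"
  proof (rule genericI)
    fix A' Y \<alpha> \<beta> \<gamma>
    assume asm [simp]: "A' \<in> Obj E" "Y \<in> Obj E" "\<alpha> \<in> Hom E B (EO T A')" "\<beta> \<in> Hom E A Y"
        "\<gamma> \<in> Hom E A' Y"
      and eq: "Comp E B (EO T A') (EO T Y) (EA T A' Y \<gamma>) \<alpha> =
        Comp E B (EO T A) (EO T Y) (EA T A Y \<beta>) g"
    obtain P p q where pb: "is_pullback E P A A' Y p q \<beta> \<gamma>"
      using ex_pullback[OF fc] asm A by metis
    then have [simp]: "P \<in> Obj E" "p \<in> Hom E P A" "q \<in> Hom E P A'"
      and sq: "Comp E P A Y \<beta> p = Comp E P A' Y \<gamma> q" by (simp_all add: is_pullback_def)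
    have Tpb: "is_pullback E (EO T P) (EO T A) (EO T A') (EO T Y) (EA T P A p) (EA T P A' q)
        (EA T A Y \<beta>) (EA T A' Y \<gamma>)"
      using pres pb unfolding preserves_pullbacks_def by blast
    obtain k where k [simp]: "k \<in> Hom E B (EO T P)"
      and kp: "Comp E B (EO T P) (EO T A) (EA T P A p) k = g"
      and kq: "Comp E B (EO T P) (EO T A') (EA T P A' q) k = \<alpha>"
      using pullback_lift[OF Tpb, of B g \<alpha>] eq by auto
    have "Comp E B (EO T P) (EO T X) (EA T P X (Comp E P A X a p)) k = h"
      using kp fac by (simp add: T.AMap_Comp flip: Comp_assoc)
    then have ex1: "\<exists>!\<delta>. \<delta> \<in> Hom E A P \<and> Comp E A P X (Comp E P A X a p) \<delta> = a \<and>
        Comp E B (EO T A) (EO T P) (EA T A P \<delta>) g = k"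
      by (intro univ) simp_all
    then obtain \<epsilon> where e [simp]: "\<epsilon> \<in> Hom E A P"
      and ea: "Comp E A P X (Comp E P A X a p) \<epsilon> = a"
      and eg: "Comp E B (EO T A) (EO T P) (EA T A P \<epsilon>) g = k" by blast
    \<comment> \<open>\<open>\<epsilon>\<close> is a section of \<open>p\<close>: over \<open>X\<close>, the only endomorphism of \<open>A\<close> fixing \<open>g\<close> is the identity.\<close>
    have "\<exists>!\<delta>. \<delta> \<in> Hom E A A \<and> Comp E A A X a \<delta> = a \<and>
        Comp E B (EO T A) (EO T A) (EA T A A \<delta>) g = g"
      by (intro univ) (simp_all add: fac)
    moreover have "Comp E A A X a (Comp E A P A p \<epsilon>) = a" using ea by (simp add: Comp_assoc)
    moreover have "Comp E B (EO T A) (EO T A) (EA T A A (Comp E A P A p \<epsilon>)) g = g"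
      using eg kp by (simp add: T.AMap_Comp flip: Comp_assoc)
    moreover have "Comp E A A X a (Id E A) = a"
        "Comp E B (EO T A) (EO T A) (EA T A A (Id E A)) g = g"
      by (simp_all add: T.AMap_Id)
    ultimately have pe: "Comp E A P A p \<epsilon> = Id E A"
      by (metis Comp_in_Hom Id_in_Hom A(1) \<open>P \<in> Obj E\<close> \<open>p \<in> Hom E P A\<close> e)
    show "\<exists>!\<delta>. \<delta> \<in> Hom E A A' \<and> Comp E B (EO T A) (EO T A') (EA T A A' \<delta>) g = \<alpha> \<and>
        Comp E A A' Y \<gamma> \<delta> = \<beta>"
    proof (intro ex1I[of _ "Comp E A P A' q \<epsilon>"] conjI)
      show "Comp E A P A' q \<epsilon> \<in> Hom E A A'" by simp
      show "Comp E B (EO T A) (EO T A') (EA T A A' (Comp E A P A' q \<epsilon>)) g = \<alpha>"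
        using eg kq by (simp add: T.AMap_Comp flip: Comp_assoc)
      have "Comp E A A' Y \<gamma> (Comp E A P A' q \<epsilon>) = Comp E A A Y \<beta> (Comp E A P A p \<epsilon>)"
        by (simp add: Comp_assoc sq)
      then show "Comp E A A' Y \<gamma> (Comp E A P A' q \<epsilon>) = \<beta>" by (simp add: pe)
    next
      fix \<delta> assume d: "\<delta> \<in> Hom E A A' \<and> Comp E B (EO T A) (EO T A') (EA T A A' \<delta>) g = \<alpha> \<and>
        Comp E A A' Y \<gamma> \<delta> = \<beta>"
      then obtain l where l [simp]: "l \<in> Hom E A P"
        and lp: "Comp E A P A p l = Id E A" and lq: "Comp E A P A' q l = \<delta>"
        using pullback_lift[OF pb, of A "Id E A" \<delta>] by auto
      have "Comp E B (EO T A) (EO T P) (EA T A P l) g = k"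
      proof (rule pullback_eqI[OF Tpb])
        have "Comp E B (EO T P) (EO T A) (EA T P A p) (Comp E B (EO T A) (EO T P) (EA T A P l) g) =
            Comp E B (EO T A) (EO T A) (EA T A A (Comp E A P A p l)) g"
          by (simp add: T.AMap_Comp[of A P] Comp_assoc)
        then show "Comp E B (EO T P) (EO T A) (EA T P A p) (Comp E B (EO T A) (EO T P) (EA T A P l) g) =
            Comp E B (EO T P) (EO T A) (EA T P A p) k" by (simp add: lp kp T.AMap_Id)
        have "Comp E B (EO T P) (EO T A') (EA T P A' q) (Comp E B (EO T A) (EO T P) (EA T A P l) g) =
            Comp E B (EO T A) (EO T A') (EA T A A' (Comp E A P A' q l)) g"
          by (simp add: T.AMap_Comp[of A P] Comp_assoc)
        then show "Comp E B (EO T P) (EO T A') (EA T P A' q) (Comp E B (EO T A) (EO T P) (EA T A P l) g) =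
            Comp E B (EO T P) (EO T A') (EA T P A' q) k" using d by (simp add: lq kq)
      qed simp_all
      moreover have "Comp E A P X (Comp E P A X a p) l = a"
        by (simp add: lp flip: Comp_assoc)
      ultimately have "l = \<epsilon>" using ex1 ea eg by (metis e l)
      then show "\<delta> = Comp E A P A' q \<epsilon>" using lq by simp
    qed
  qed simp_all
  then show ?thesis using that A fac by blast
qed

end

context category
begin

text \<open>Generic morphisms compose in the Kleisli category of \<open>T\<close>: the naturality squares of the
  multiplication, being pullbacks, lift a problem for the composite to one for \<open>f\<close>, whose solution is
  in turn a problem for \<open>g\<close>.\<close>

lemma generic_Mult:
  assumes T: "is_functor C C (Endo T)"
    and mult: "cartesian_nat_trans C C (comp_func (Endo T) (Endo T)) (Endo T) (Mult T)"
    and f: "generic C T B D f" and g: "generic C T D A g"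
  shows "generic C T B A (Comp C B (EO T (EO T A)) (EO T A) (Mult T A)
    (Comp C B (EO T D) (EO T (EO T A)) (EA T D (EO T A) g) f))"
    (is "generic C T B A ?k")
proof (rule genericI)
  interpret monad_endofunctor C T
    using T by (simp add: monad_endofunctor_def monad_endofunctor_axioms_def category_axioms)
  interpret \<mu>: nat_trans C C "comp_func (Endo T) (Endo T)" "Endo T" "Mult T"
    using mult by (simp add: cartesian_nat_trans_def)
  note [simp] = genericD[OF f] genericD[OF g]
  have [simp]: "Mult T X \<in> Hom C (EO T (EO T X)) (EO T X)" if "X \<in> Obj C" for X
    using \<mu>.component_in_Hom[OF that] by simp
  have \<mu>: "Comp C (EO T (EO T X)) (EO T (EO T Y)) (EO T Y) (Mult T Y)
      (EA T (EO T X) (EO T Y) (EA T X Y u)) =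
    Comp C (EO T (EO T X)) (EO T X) (EO T Y) (EA T X Y u) (Mult T X)"
    if "X \<in> Obj C" "Y \<in> Obj C" "u \<in> Hom C X Y" for X Y u
    using \<mu>.naturality[OF that] by simp
  show "B \<in> Obj C" "A \<in> Obj C" "?k \<in> Hom C B (EO T A)" by simp_all
  \<comment> \<open>Naturality of the multiplication moves an arrow out of \<open>A\<close> past the composite.\<close>
  have push: "Comp C B (EO T A) (EO T Y) (EA T A Y u) ?k =
      Comp C B (EO T (EO T Y)) (EO T Y) (Mult T Y)
        (Comp C B (EO T D) (EO T (EO T Y)) (EA T D (EO T Y) (Comp C D (EO T A) (EO T Y) (EA T A Y u) g)) f)"
    if "Y \<in> Obj C" "u \<in> Hom C A Y" for Y u
    using that by (simp add: T.AMap_Comp[of D] Comp_assoc \<mu>)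
  fix A' X \<alpha> \<beta> \<gamma>
  assume [simp]: "A' \<in> Obj C" "X \<in> Obj C" "\<alpha> \<in> Hom C B (EO T A')" "\<beta> \<in> Hom C A X" "\<gamma> \<in> Hom C A' X"
    and eq: "Comp C B (EO T A') (EO T X) (EA T A' X \<gamma>) \<alpha> = Comp C B (EO T A) (EO T X) (EA T A X \<beta>) ?k"
  have pb: "is_pullback C (EO T (EO T A')) (EO T (EO T X)) (EO T A') (EO T X)
      (EA T (EO T A') (EO T X) (EA T A' X \<gamma>)) (Mult T A') (Mult T X) (EA T A' X \<gamma>)"
    using mult by (simp add: cartesian_nat_trans_def)
  let ?\<beta> = "Comp C D (EO T A) (EO T X) (EA T A X \<beta>) g" and ?\<gamma> = "EA T A' X \<gamma>"
  obtain \<alpha>' where a' [simp]: "\<alpha>' \<in> Hom C B (EO T (EO T A'))"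
    and a'1: "Comp C B (EO T (EO T A')) (EO T (EO T X)) (EA T (EO T A') (EO T X) ?\<gamma>) \<alpha>' =
      Comp C B (EO T D) (EO T (EO T X)) (EA T D (EO T X) ?\<beta>) f"
    and a'2: "Comp C B (EO T (EO T A')) (EO T A') (Mult T A') \<alpha>' = \<alpha>"
    by (rule pullback_lift[OF pb, of B "Comp C B (EO T D) (EO T (EO T X)) (EA T D (EO T X) ?\<beta>) f" \<alpha>])
      (simp_all add: eq push)
  obtain \<epsilon> where e [simp]: "\<epsilon> \<in> Hom C D (EO T A')"
    and e1: "Comp C B (EO T D) (EO T (EO T A')) (EA T D (EO T A') \<epsilon>) f = \<alpha>'"
    and e2: "Comp C D (EO T A') (EO T X) ?\<gamma> \<epsilon> = ?\<beta>"
    by (rule generic_lift[OF f, of "EO T A'" "EO T X" \<alpha>' ?\<beta> ?\<gamma>]) (simp_all add: a'1)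
  obtain \<delta> where d: "\<delta> \<in> Hom C A A'" "Comp C D (EO T A) (EO T A') (EA T A A' \<delta>) g = \<epsilon>"
      "Comp C A A' X \<gamma> \<delta> = \<beta>"
    by (rule generic_lift[OF g, of A' X \<epsilon> \<beta> \<gamma>]) (simp_all add: e2)
  show "\<exists>!\<delta>. \<delta> \<in> Hom C A A' \<and> Comp C B (EO T A) (EO T A') (EA T A A' \<delta>) ?k = \<alpha> \<and>
      Comp C A A' X \<gamma> \<delta> = \<beta>"
  proof (intro ex1I[of _ \<delta>] conjI)
    show "Comp C B (EO T A) (EO T A') (EA T A A' \<delta>) ?k = \<alpha>"
      using d by (simp add: push e1 a'2)
  next
    fix \<delta>' assume d': "\<delta>' \<in> Hom C A A' \<and> Comp C B (EO T A) (EO T A') (EA T A A' \<delta>') ?k = \<alpha> \<and>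
      Comp C A A' X \<gamma> \<delta>' = \<beta>"
    then have [simp]: "\<delta>' \<in> Hom C A A'" by simp
    let ?\<epsilon> = "Comp C D (EO T A) (EO T A') (EA T A A' \<delta>') g"
    have ge: "Comp C D (EO T A') (EO T X) ?\<gamma> ?\<epsilon> = ?\<beta>"
      using d' by (simp add: Comp_assoc flip: T.AMap_Comp)
    have "Comp C B (EO T D) (EO T (EO T A')) (EA T D (EO T A') ?\<epsilon>) f = \<alpha>'"
    proof (rule pullback_eqI[OF pb])
      have "Comp C B (EO T (EO T A')) (EO T (EO T X)) (EA T (EO T A') (EO T X) ?\<gamma>)
          (Comp C B (EO T D) (EO T (EO T A')) (EA T D (EO T A') \<zeta>) f) =
        Comp C B (EO T D) (EO T (EO T X))
          (EA T D (EO T X) (Comp C D (EO T A') (EO T X) ?\<gamma> \<zeta>)) f"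
        if "\<zeta> \<in> Hom C D (EO T A')" for \<zeta>
        using that by (simp add: T.AMap_Comp[of D] Comp_assoc)
      from this[of ?\<epsilon>]
      show "Comp C B (EO T (EO T A')) (EO T (EO T X)) (EA T (EO T A') (EO T X) ?\<gamma>)
          (Comp C B (EO T D) (EO T (EO T A')) (EA T D (EO T A') ?\<epsilon>) f) =
        Comp C B (EO T (EO T A')) (EO T (EO T X)) (EA T (EO T A') (EO T X) ?\<gamma>) \<alpha>'"
        by (simp add: ge a'1)
      show "Comp C B (EO T (EO T A')) (EO T A') (Mult T A')
          (Comp C B (EO T D) (EO T (EO T A')) (EA T D (EO T A') ?\<epsilon>) f) =
        Comp C B (EO T (EO T A')) (EO T A') (Mult T A') \<alpha>'"
        using d' push[of A' \<delta>'] a'2 by simp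
    qed simp_all
    then have eps: "?\<epsilon> = \<epsilon>"
      by - (rule generic_eqI[OF f, of "EO T A'" "EO T X" ?\<gamma>], simp_all add: e1 e2 ge)
    show "\<delta>' = \<delta>"
      by (rule generic_eqI[OF g, of A' X \<gamma>]) (use d d' eps in simp_all)
  qed (use d in simp_all)
qed

text \<open>A morphism to \<open>S A\<close> is \<open>S\<close>-generic if \<open>\<phi> : S \<Rightarrow> T\<close> is cartesian and
  its image in \<open>T A\<close> is \<open>T\<close>-generic.\<close>

lemma generic_over:
  assumes \<phi>: "cartesian_nat_trans C C (Endo S) (Endo T) \<phi>"
    and A: "A \<in> Obj C" and g: "g \<in> Hom C B (EO S A)"
    and gen: "generic C T B A (Comp C B (EO S A) (EO T A) (\<phi> A) g)"
  shows "generic C S B A g"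
proof (rule genericI)
  interpret \<phi>: nat_trans C C "Endo S" "Endo T" \<phi> using \<phi> by (simp add: cartesian_nat_trans_def)
  interpret TT: monad_endofunctor C T
    by (simp add: monad_endofunctor_def monad_endofunctor_axioms_def category_axioms \<phi>.G.is_functor_axioms)
  note [simp] = A g genericD(1)[OF gen] \<phi>.component_in_Hom
  show "B \<in> Obj C" "A \<in> Obj C" "g \<in> Hom C B (EO S A)" by simp_all
  fix A' X \<alpha> \<beta> \<gamma>
  assume [simp]: "A' \<in> Obj C" "X \<in> Obj C" "\<alpha> \<in> Hom C B (EO S A')" "\<beta> \<in> Hom C A X" "\<gamma> \<in> Hom C A' X"
    and eq: "Comp C B (EO S A') (EO S X) (EA S A' X \<gamma>) \<alpha> = Comp C B (EO S A) (EO S X) (EA S A X \<beta>) g"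
  have pb: "is_pullback C (EO S A') (EO S X) (EO T A') (EO T X) (EA S A' X \<gamma>) (\<phi> A') (\<phi> X) (EA T A' X \<gamma>)"
    using \<phi> by (simp add: cartesian_nat_trans_def)
  have nat: "Comp C B (EO S Z) (EO T Z) (\<phi> Z) (Comp C B (EO S Y) (EO S Z) (EA S Y Z u) v) =
      Comp C B (EO T Y) (EO T Z) (EA T Y Z u) (Comp C B (EO S Y) (EO T Y) (\<phi> Y) v)"
    if "Y \<in> Obj C" "Z \<in> Obj C" "u \<in> Hom C Y Z" "v \<in> Hom C B (EO S Y)" for Y Z u v
    using that by (simp add: Comp_assoc \<phi>.naturality)
  let ?\<alpha> = "Comp C B (EO S A') (EO T A') (\<phi> A') \<alpha>"
  obtain \<delta> where d [simp]: "\<delta> \<in> Hom C A A'"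
    and d1: "Comp C B (EO T A) (EO T A') (EA T A A' \<delta>) (Comp C B (EO S A) (EO T A) (\<phi> A) g) = ?\<alpha>"
    and d2: "Comp C A A' X \<gamma> \<delta> = \<beta>"
    by (rule generic_lift[OF gen, of A' X ?\<alpha> \<beta> \<gamma>]) (simp_all add: eq flip: nat)
  show "\<exists>!\<delta>. \<delta> \<in> Hom C A A' \<and> Comp C B (EO S A) (EO S A') (EA S A A' \<delta>) g = \<alpha> \<and>
      Comp C A A' X \<gamma> \<delta> = \<beta>"
  proof (intro ex1I[of _ \<delta>] conjI)
    show "Comp C B (EO S A) (EO S A') (EA S A A' \<delta>) g = \<alpha>"
    proof (rule pullback_eqI[OF pb])
      show "Comp C B (EO S A') (EO S X) (EA S A' X \<gamma>) (Comp C B (EO S A) (EO S A') (EA S A A' \<delta>) g) =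
          Comp C B (EO S A') (EO S X) (EA S A' X \<gamma>) \<alpha>"
        by (simp add: eq Comp_assoc d2 flip: \<phi>.F.AMap_Comp)
    qed (simp_all add: nat d1)
  next
    fix \<delta>' assume d': "\<delta>' \<in> Hom C A A' \<and> Comp C B (EO S A) (EO S A') (EA S A A' \<delta>') g = \<alpha> \<and>
      Comp C A A' X \<gamma> \<delta>' = \<beta>"
    then have "Comp C B (EO T A) (EO T A') (EA T A A' \<delta>') (Comp C B (EO S A) (EO T A) (\<phi> A) g) = ?\<alpha>"
      using nat[of A A' \<delta>' g] by simp
    with d' show "\<delta>' = \<delta>"
      by - (rule TT.generic_eqI[OF gen, of A' X \<gamma>], simp_all add: d1 d2)
  qed (simp_all add: d2)
qed

lemma generic_factorisation_over:
  assumes \<phi>: "cartesian_nat_trans C C (Endo S) (Endo T) \<phi>"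
    and X: "X \<in> Obj C" and a: "a \<in> Hom C A X" and h: "h \<in> Hom C B (EO S X)"
    and gen: "generic C T B A k"
    and fac: "Comp C B (EO T A) (EO T X) (EA T A X a) k = Comp C B (EO S X) (EO T X) (\<phi> X) h"
  obtains g where "generic C S B A g" "Comp C B (EO S A) (EO S X) (EA S A X a) g = h"
proof -
  note k = genericD[OF gen]
  have pb: "is_pullback C (EO S A) (EO S X) (EO T A) (EO T X) (EA S A X a) (\<phi> A) (\<phi> X) (EA T A X a)"
    using \<phi> k(2) X a by (simp add: cartesian_nat_trans_def)
  obtain g where g: "g \<in> Hom C B (EO S A)" "Comp C B (EO S A) (EO S X) (EA S A X a) g = h"
      "Comp C B (EO S A) (EO T A) (\<phi> A) g = k"
    by (rule pullback_lift[OF pb, of B h k]) (simp_all only: fac h k)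
  have "generic C S B A g" by (rule generic_over[OF \<phi>]) (simp_all add: g gen k)
  with g that show ?thesis by blast
qed

end

section \<open>Arities from generic factorisations\<close>

context locally_small_category
begin

text \<open>By the universal property of generic morphisms, the factorisations \<open>h = S a \<circ> g\<close> of a fixed
  \<open>h : B \<rightarrow> S X\<close> with \<open>a\<close> in \<open>\<A>/X\<close> are all identified with a generic one; so evaluating a cocone at a
  generic factorisation gives the unique comparison map from \<open>E(B, S X)\<close>.\<close>

lemma has_arities_if_generic_factorisation:
  assumes \<A>: "\<A> \<subseteq> Obj E" and S: "is_functor E E (Endo S)"
    and fac: "\<And>B X h. \<lbrakk>B \<in> \<A>; X \<in> Obj E; h \<in> Hom E B (EO S X)\<rbrakk> \<Longrightarrow>
      \<exists>A\<in>\<A>. \<exists>a\<in>Hom E A X. \<exists>g. generic E S B A g \<and> Comp E B (EO S A) (EO S X) (EA S A X a) g = h"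
  shows "has_arities E S \<A>"
  unfolding has_arities_def Let_def
proof (rule ballI)
  fix X assume X [simp]: "X \<in> Obj E"
  interpret S: is_functor E E "Endo S" by fact
  let ?J = "over_cat E \<A> X" and ?P = "presheaf_cat (full_sub E \<A>)"
    and ?F = "comp_func (nerve E \<A>) (Endo S)"
  let ?\<tau> = "\<lambda>j. AMap ?F (OMap over_proj j) X (canonical_cocone j)"
  interpret F: is_functor E ?P ?F using S is_functor_nerve[OF \<A>] by (rule is_functor_comp)
  interpret J: category ?J using \<A> X by (rule category_over)
  have ob [simp]: "A \<in> Obj E" if "A \<in> \<A>" for A using that \<A> by blast
  have cocone: "cocone ?J ?P (comp_func ?F over_proj) (OMap ?F X) ?\<tau>"
    unfolding cocone_def
  proof (intro conjI nat_transI)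
    show "OMap ?F X \<in> Obj ?P" using X by (rule F.OMap_in_Obj)
    then show "is_functor ?J ?P (const_func ?P (OMap ?F X))"
      using J.category_axioms F.D.category_axioms by (intro is_functor_const)
    show "is_functor ?J ?P (comp_func ?F over_proj)"
      using is_functor_over_proj[OF \<A> X] F.is_functor_axioms by (rule is_functor_comp)
    fix i j f assume i: "i \<in> Obj ?J" and j: "j \<in> Obj ?J" and f: "f \<in> Hom ?J i j"
    obtain A a C c where [simp]: "i = (A, a)" "j = (C, c)" by fastforce
    have A: "A \<in> Obj E" "a \<in> Hom E A X" "C \<in> Obj E" "c \<in> Hom E C X" "f \<in> Hom E A C"
        "Comp E A C X c f = a"
      using i j f by simp_all
    have "Comp ?P (OMap ?F A) (OMap ?F C) (OMap ?F X) (AMap ?F C X c) (AMap ?F A C f) = AMap ?F A X a"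
      using F.AMap_Comp[of A C X f c] A by simp
    also have "\<dots> = Comp ?P (OMap ?F A) (OMap ?F X) (OMap ?F X) (Id ?P (OMap ?F X)) (AMap ?F A X a)"
      using A by (intro F.D.Comp_Id_left[symmetric] F.OMap_in_Obj F.AMap_in_Hom X)
    finally show "Comp ?P (OMap (comp_func ?F over_proj) i) (OMap (comp_func ?F over_proj) j)
        (OMap (const_func ?P (OMap ?F X)) j) (?\<tau> j) (AMap (comp_func ?F over_proj) i j f) =
      Comp ?P (OMap (comp_func ?F over_proj) i) (OMap (const_func ?P (OMap ?F X)) i)
        (OMap (const_func ?P (OMap ?F X)) j) (AMap (const_func ?P (OMap ?F X)) i j f) (?\<tau> i)"
      by (simp add: canonical_cocone_def)
  next
    fix j assume "j \<in> Obj ?J"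
    then show "?\<tau> j \<in> Hom ?P (OMap (comp_func ?F over_proj) j) (OMap (const_func ?P (OMap ?F X)) j)"
      using F.AMap_in_Hom[of "fst j" X "snd j"] by (auto simp: canonical_cocone_def)
  qed
  have "\<exists>!h. h \<in> Hom ?P (OMap ?F X) d \<and>
      (\<forall>j\<in>Obj ?J. Comp ?P (OMap (comp_func ?F over_proj) j) (OMap ?F X) d h (?\<tau> j) = \<sigma> j)"
    if d: "cocone ?J ?P (comp_func ?F over_proj) d \<sigma>" for d \<sigma>
  proof -
    interpret \<sigma>: nat_trans ?J ?P "comp_func ?F over_proj" "const_func ?P d" \<sigma>
      using d by (simp add: cocone_def)
    interpret d: is_functor "op_cat (full_sub E \<A>)" set_cat d
      using d by (simp add: cocone_def presheaf_cat_def)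
    have \<sigma>: "\<sigma> (A, a) \<in> extensional \<A>"
        "nat_trans (op_cat (full_sub E \<A>)) set_cat (nerve_obj E (EO S A)) d (\<sigma> (A, a))"
      if "A \<in> \<A>" "a \<in> Hom E A X" for A a
      using \<sigma>.component_in_Hom[of "(A, a)"] that by (simp_all add: presheaf_cat_def)
    have \<sigma>_ext: "\<sigma> (A, a) B \<in> Hom E B (EO S A) \<rightarrow>\<^sub>E OMap d B"
      if "A \<in> \<A>" "a \<in> Hom E A X" "B \<in> \<A>" for A a B
      using nat_trans.component_in_Hom[OF \<sigma>(2), of A a B] that by simp
    then have \<sigma>_in: "\<sigma> (A, a) B x \<in> OMap d B"
      if "A \<in> \<A>" "a \<in> Hom E A X" "B \<in> \<A>" "x \<in> Hom E B (EO S A)" for A a B x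
      using that by blast
    have \<sigma>_nat: "\<sigma> (A, a) B' (Comp E B' B (EO S A) x k) = AMap d B B' k (\<sigma> (A, a) B x)"
      if "A \<in> \<A>" "a \<in> Hom E A X" "B \<in> \<A>" "B' \<in> \<A>" "x \<in> Hom E B (EO S A)" "k \<in> Hom E B' B" for A a B B' x k
      using fun_cong[OF nat_trans.naturality[OF \<sigma>(2), of A a B B' k], of x] that
      by (simp add: compose_def)
    have \<sigma>_cocone: "\<sigma> (C, c) B (Comp E B (EO S A) (EO S C) (EA S A C f) x) = \<sigma> (A, a) B x"
      if A: "A \<in> \<A>" "a \<in> Hom E A X" "C \<in> \<A>" "c \<in> Hom E C X" "f \<in> Hom E A C"
        "Comp E A C X c f = a" and B: "B \<in> \<A>" "x \<in> Hom E B (EO S A)" for A a C c f B x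
    proof -
      have "\<sigma> (A, a) = Comp ?P (OMap ?F A) d d (Id ?P d) (\<sigma> (A, a))"
        using \<sigma>.component_in_Hom[of "(A, a)"] d A F.OMap_in_Obj[of A]
        by (intro F.D.Comp_Id_left[symmetric]) (auto simp: cocone_def)
      also have "\<dots> = Comp ?P (OMap ?F A) (OMap ?F C) d (\<sigma> (C, c)) (AMap ?F A C f)"
        using \<sigma>.naturality[of "(A, a)" "(C, c)" f] A by simp
      finally show ?thesis using B A by (simp add: presheaf_cat_def compose_def)
    qed
    \<comment> \<open>The value of \<open>\<sigma>\<close> at a generic factorisation of \<open>x\<close>; by \<open>h\<close> below, any other factorisation
      through an object of \<open>\<A>\<close> gives the same value.\<close>
    define h where "h = (\<lambda>B\<in>\<A>. \<lambda>x\<in>Hom E B (EO S X). SOME y. \<exists>A\<in>\<A>. \<exists>a\<in>Hom E A X. \<exists>g.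
      generic E S B A g \<and> Comp E B (EO S A) (EO S X) (EA S A X a) g = x \<and> y = \<sigma> (A, a) B g)"
    have h: "h B (Comp E B (EO S C) (EO S X) (EA S C X c) \<alpha>) = \<sigma> (C, c) B \<alpha>"
      if C [simp]: "C \<in> \<A>" "c \<in> Hom E C X" "B \<in> \<A>" "\<alpha> \<in> Hom E B (EO S C)" for B C c \<alpha>
    proof -
      let ?x = "Comp E B (EO S C) (EO S X) (EA S C X c) \<alpha>"
      let ?Q = "\<lambda>y. \<exists>A\<in>\<A>. \<exists>a\<in>Hom E A X. \<exists>g. generic E S B A g \<and>
          Comp E B (EO S A) (EO S X) (EA S A X a) g = ?x \<and> y = \<sigma> (A, a) B g"
      have x: "?x \<in> Hom E B (EO S X)" by simp
      have ex: "\<exists>y. ?Q y" using fac[OF C(3) X x] by blast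
      have hx: "h B ?x = (SOME y. ?Q y)" using x by (simp add: h_def)
      have "?Q (h B ?x)" unfolding hx by (rule someI_ex) (rule ex)
      then obtain A a g where A [simp]: "A \<in> \<A>" "a \<in> Hom E A X" and g: "generic E S B A g"
        and eq: "Comp E B (EO S A) (EO S X) (EA S A X a) g = ?x" and y: "h B ?x = \<sigma> (A, a) B g"
        by blast
      obtain \<delta> where "\<delta> \<in> Hom E A C" "Comp E B (EO S A) (EO S C) (EA S A C \<delta>) g = \<alpha>"
          "Comp E A C X c \<delta> = a"
        by (rule generic_lift[OF g, of C X \<alpha> a c]) (simp_all add: eq)
      then show ?thesis
        using \<sigma>_cocone[of A a C c \<delta> B g] genericD[OF g] y by simp
    qed
    have factor: "\<exists>A\<in>\<A>. \<exists>a\<in>Hom E A X. \<exists>g\<in>Hom E B (EO S A).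
        x = Comp E B (EO S A) (EO S X) (EA S A X a) g \<and> h B x = \<sigma> (A, a) B g"
      if x: "B \<in> \<A>" "x \<in> Hom E B (EO S X)" for B x
    proof -
      obtain A a g where A: "A \<in> \<A>" "a \<in> Hom E A X" "generic E S B A g"
        "Comp E B (EO S A) (EO S X) (EA S A X a) g = x" using fac[OF x(1) X x(2)] by blast
      then have "g \<in> Hom E B (EO S A)" by (simp add: genericD)
      then show ?thesis using A h[of A a B g] x by blast
    qed
    show ?thesis
    proof (rule ex1I[of _ h])
      have "nat_trans (op_cat (full_sub E \<A>)) set_cat (nerve_obj E (EO S X)) d h"
      proof (intro nat_transI is_functor_nerve_obj \<A> d.is_functor_axioms)
        fix B assume B: "B \<in> Obj (op_cat (full_sub E \<A>))"
        have "h B x \<in> OMap d B" if "x \<in> Hom E B (EO S X)" for x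
          using factor[of B x] B that \<sigma>_in by auto
        then show "h B \<in> Hom set_cat (OMap (nerve_obj E (EO S X)) B) (OMap d B)"
          using B by (auto simp: h_def)
      next
        fix B B' k assume "B \<in> Obj (op_cat (full_sub E \<A>))" "B' \<in> Obj (op_cat (full_sub E \<A>))"
          "k \<in> Hom (op_cat (full_sub E \<A>)) B B'"
        then have B [simp]: "B \<in> \<A>" "B' \<in> \<A>" "k \<in> Hom E B' B" by simp_all
        have "h B' (Comp E B' B (EO S X) x k) = AMap d B B' k (h B x)"
          if x: "x \<in> Hom E B (EO S X)" for x
        proof -
          obtain A a g where A [simp]: "A \<in> \<A>" "a \<in> Hom E A X" "g \<in> Hom E B (EO S A)"
            and xg: "x = Comp E B (EO S A) (EO S X) (EA S A X a) g" and hx: "h B x = \<sigma> (A, a) B g"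
            using factor[OF B(1) x] by blast
          have "Comp E B' B (EO S X) x k =
              Comp E B' (EO S A) (EO S X) (EA S A X a) (Comp E B' B (EO S A) g k)"
            unfolding xg by (simp add: Comp_assoc)
          then have "h B' (Comp E B' B (EO S X) x k) = \<sigma> (A, a) B' (Comp E B' B (EO S A) g k)"
            by (simp add: h)
          then show ?thesis by (simp add: hx \<sigma>_nat)
        qed
        then show "Comp set_cat (OMap (nerve_obj E (EO S X)) B) (OMap (nerve_obj E (EO S X)) B') (OMap d B')
            (h B') (AMap (nerve_obj E (EO S X)) B B' k) =
          Comp set_cat (OMap (nerve_obj E (EO S X)) B) (OMap d B) (OMap d B') (AMap d B B' k) (h B)"
          by (simp add: compose_def fun_eq_iff)
      qed simp
      then have "h \<in> Hom ?P (OMap ?F X) d" by (simp add: presheaf_cat_def h_def)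
      moreover have "Comp ?P (OMap (comp_func ?F over_proj) (A, a)) (OMap ?F X) d h (?\<tau> (A, a)) = \<sigma> (A, a)"
        if A: "A \<in> \<A>" "a \<in> Hom E A X" for A a
      proof (rule extensionalityI[of _ \<A>])
        fix B assume B: "B \<in> \<A>"
        show "Comp ?P (OMap (comp_func ?F over_proj) (A, a)) (OMap ?F X) d h (?\<tau> (A, a)) B = \<sigma> (A, a) B"
          by (rule extensionalityI[of _ "Hom E B (EO S A)"])
            (use A B \<sigma>_ext[OF A B] in \<open>auto simp: presheaf_cat_def canonical_cocone_def compose_def h PiE_iff\<close>)
      qed (use \<sigma>(1)[OF A] in \<open>simp_all add: presheaf_cat_def\<close>)
      ultimately show "h \<in> Hom ?P (OMap ?F X) d \<and>
          (\<forall>j\<in>Obj ?J. Comp ?P (OMap (comp_func ?F over_proj) j) (OMap ?F X) d h (?\<tau> j) = \<sigma> j)"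
        by auto
    next
      fix h' assume h': "h' \<in> Hom ?P (OMap ?F X) d \<and>
          (\<forall>j\<in>Obj ?J. Comp ?P (OMap (comp_func ?F over_proj) j) (OMap ?F X) d h' (?\<tau> j) = \<sigma> j)"
      then interpret h': nat_trans "op_cat (full_sub E \<A>)" set_cat "nerve_obj E (EO S X)" d h'
        by (simp add: presheaf_cat_def)
      have h'_eq: "h' B (Comp E B (EO S C) (EO S X) (EA S C X c) \<alpha>) = \<sigma> (C, c) B \<alpha>"
        if C: "C \<in> \<A>" "c \<in> Hom E C X" "B \<in> \<A>" "\<alpha> \<in> Hom E B (EO S C)" for B C c \<alpha>
      proof -
        have "Comp ?P (OMap (comp_func ?F over_proj) (C, c)) (OMap ?F X) d h' (?\<tau> (C, c)) B \<alpha> = \<sigma> (C, c) B \<alpha>"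
          using h' C by simp
        then show ?thesis using C by (simp add: presheaf_cat_def canonical_cocone_def compose_def)
      qed
      show "h' = h"
      proof (rule extensionalityI[of _ \<A>])
        fix B assume B: "B \<in> \<A>"
        show "h' B = h B"
        proof (rule extensionalityI[of _ "Hom E B (EO S X)"])
          show "h' B \<in> extensional (Hom E B (EO S X))"
            using h'.component_in_Hom[of B] B by (simp add: PiE_iff)
          show "h B \<in> extensional (Hom E B (EO S X))" using B by (simp add: h_def)
          fix x assume "x \<in> Hom E B (EO S X)"
          then show "h' B x = h B x" using factor[OF B] h'_eq B by metis
        qed
      qed (use h' in \<open>simp_all add: presheaf_cat_def h_def\<close>)
    qed
  qed
  with cocone show "colimit_cocone ?J ?P (comp_func ?F over_proj) (OMap ?F X) ?\<tau>"
    unfolding colimit_cocone_def by blast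
qed

end

section \<open>The generically closed dense generator\<close>

theorem theorem2p9:
  fixes E :: "('o, 'u) cat" and T :: "('o, 'u) monad" and \<A> :: "'o set"
  assumes "small_universe TYPE('u)"
    and "category E" and "locally_small E" and "finitely_complete E"
    and "strongly_cartesian_monad E T"
    and "dense_generator E \<A>"
  shows "\<exists>\<A>\<^sub>T. least_closed_dense_generator E T \<A> \<A>\<^sub>T \<and>
    (\<forall>S \<phi>. cartesian_monad_over E T S \<phi> \<longrightarrow> has_arities E S \<A>\<^sub>T)"
proof -
  have lra: "local_right_adjoint E E (Endo T)" and pres: "preserves_pullbacks E E (Endo T)"
    and mult: "cartesian_nat_trans E E (comp_func (Endo T) (Endo T)) (Endo T) (Mult T)"
    using assms(5) by (simp_all add: strongly_cartesian_monad_def cartesian_monad_def)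
  then have TF: "is_functor E E (Endo T)" by (simp add: local_right_adjoint_def)
  interpret locally_small_category E
    using assms(2,3)
    by (simp add: locally_small_category_def locally_small_category_axioms_def locally_small_def)
  interpret monad_endofunctor E T
    using TF by (simp add: monad_endofunctor_def monad_endofunctor_axioms_def category_axioms)
  have \<A>: "\<A> \<subseteq> Obj E" "small TYPE('u) \<A>" using assms(6) by (simp_all add: dense_generator_def)
  note factor = local_right_adjoint_generic_factorisation[OF assms(4) lra pres]
  obtain I where I [simp]: "I \<in> Obj E" and bang: "\<And>X. X \<in> Obj E \<Longrightarrow> \<exists>!t. t \<in> Hom E X I"
    using ex_terminal[OF assms(4)] by blast
  \<comment> \<open>\<open>A\<close> is the codomain of the generic part of \<open>h : B \<rightarrow> T I\<close>. A generic morphism is determined up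
    to isomorphism by its composite to \<open>T I\<close>, so one codomain for each \<open>h\<close> is enough, and this
    keeps \<open>\<A>T\<close> small.\<close>
  define Q where "Q B h A \<longleftrightarrow> (\<exists>a\<in>Hom E A I. \<exists>g. generic E T B A g \<and>
      Comp E B (EO T A) (EO T I) (EA T A I a) g = h)" for B h A
  define \<A>1 where "\<A>1 = (\<lambda>(B, h). SOME A. Q B h A) ` (SIGMA B:\<A>. Hom E B (EO T I))"
  define \<A>T where "\<A>T = \<A> \<union> \<A>1"
  have Q: "Q B h (SOME A. Q B h A)" if "B \<in> \<A>" "h \<in> Hom E B (EO T I)" for B h
  proof (rule someI_ex)
    have "B \<in> Obj E" using that \<A> by blast
    from factor[OF this I that(2)] show "\<exists>A. Q B h A" unfolding Q_def by metis
  qed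
  have \<A>1_gen: "\<exists>B\<in>\<A>. \<exists>g. generic E T B A g" if A: "A \<in> \<A>1" for A
  proof -
    obtain B h where "B \<in> \<A>" "h \<in> Hom E B (EO T I)" "A = (SOME A. Q B h A)"
      using A by (auto simp: \<A>1_def)
    with Q[of B h] show ?thesis by (auto simp: Q_def)
  qed
  have sub: "\<A>T \<subseteq> Obj E" using \<A> \<A>1_gen by (auto simp: \<A>T_def dest: genericD)
  have small: "small TYPE('u) \<A>T"
    unfolding \<A>T_def \<A>1_def using \<A> assms(1)
    by (intro small_Un small_image small_Sigma Hom_small) auto
  have closed_\<A>: "\<exists>A'\<in>\<A>T. isomorphic E A A'" if B: "B \<in> \<A>" and g: "generic E T B A g" for A B g
  proof -
    note [simp] = genericD[OF g]
    obtain t where t [simp]: "t \<in> Hom E A I" using bang[of A] by auto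
    let ?h = "Comp E B (EO T A) (EO T I) (EA T A I t) g"
    have hin: "?h \<in> Hom E B (EO T I)" by simp
    let ?A = "SOME A'. Q B ?h A'"
    from Q[OF B hin] obtain a' g' where "a' \<in> Hom E ?A I" "generic E T B ?A g'"
      "Comp E B (EO T ?A) (EO T I) (EA T ?A I a') g' = ?h" unfolding Q_def by blast
    then have "isomorphic E A ?A" by (intro generic_unique[OF g _ I t]) auto
    moreover have "?A \<in> \<A>T" using B hin by (auto simp: \<A>T_def \<A>1_def)
    ultimately show ?thesis by blast
  qed
  have closed: "generically_closed E T \<A>T"
    unfolding generically_closed_def
  proof (intro ballI allI impI)
    fix B A g assume B: "B \<in> \<A>T" and g: "generic E T B A g"
    show "\<exists>A'\<in>\<A>T. isomorphic E A A'"
    proof (cases "B \<in> \<A>")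
      case True then show ?thesis using g by (rule closed_\<A>)
    next
      case False
      with B have "B \<in> \<A>1" by (simp add: \<A>T_def)
      then obtain B0 f where "B0 \<in> \<A>" "generic E T B0 B f" using \<A>1_gen by blast
      then show ?thesis using generic_Mult[OF TF mult _ g] closed_\<A> by blast
    qed
  qed
  have least: "\<exists>B\<in>\<B>. isomorphic E A B"
    if "\<A> \<subseteq> \<B>" "generically_closed E T \<B>" "A \<in> \<A>T" for A \<B>
  proof (cases "A \<in> \<A>")
    case True then show ?thesis using that(1) \<A> isomorphic_refl by blast
  next
    case False
    with that(3) have "A \<in> \<A>1" by (simp add: \<A>T_def)
    then obtain B g where B: "B \<in> \<A>" "generic E T B A g" using \<A>1_gen by blast
    then show ?thesis using that(1,2) genericD(2)[OF B(2)] unfolding generically_closed_def by blast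
  qed
  have "least_closed_dense_generator E T \<A> \<A>T"
    unfolding least_closed_dense_generator_def
    using dense_generator_mono[OF assms(6) _ sub small] closed least by (auto simp: \<A>T_def)
  moreover have "has_arities E S \<A>T" if S: "cartesian_monad_over E T S \<phi>" for S \<phi>
  proof (rule has_arities_if_generic_factorisation[OF sub])
    have \<phi>: "cartesian_nat_trans E E (Endo S) (Endo T) \<phi>"
      using S by (simp add: cartesian_monad_over_def)
    then interpret \<phi>: nat_trans E E "Endo S" "Endo T" \<phi> by (simp add: cartesian_nat_trans_def)
    show "is_functor E E (Endo S)" by (rule \<phi>.F.is_functor_axioms)
    fix B X h assume B: "B \<in> \<A>T" and X [simp]: "X \<in> Obj E" and h [simp]: "h \<in> Hom E B (EO S X)"
    have [simp]: "B \<in> Obj E" using B sub by blast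
    note [simp] = \<phi>.component_in_Hom
    have h\<phi>: "Comp E B (EO S X) (EO T X) (\<phi> X) h \<in> Hom E B (EO T X)" by simp
    obtain A0 a0 g0 where g0: "generic E T B A0 g0" and a0 [simp]: "a0 \<in> Hom E A0 X"
      and fac0: "Comp E B (EO T A0) (EO T X) (EA T A0 X a0) g0 = Comp E B (EO S X) (EO T X) (\<phi> X) h"
      by (rule factor[OF \<open>B \<in> Obj E\<close> X h\<phi>])
    note [simp] = genericD[OF g0]
    obtain A i j where A: "A \<in> \<A>T" and ij [simp]: "i \<in> Hom E A0 A" "j \<in> Hom E A A0"
      and ji: "Comp E A0 A A0 j i = Id E A0" and ij': "Comp E A A0 A i j = Id E A"
      using closed B g0 genericD(2)[OF g0] unfolding generically_closed_def isomorphic_def by metis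
    have [simp]: "A \<in> Obj E" using A sub by blast
    let ?g = "Comp E B (EO T A0) (EO T A) (EA T A0 A i) g0" and ?a = "Comp E A A0 X a0 j"
    have gen: "generic E T B A ?g" by (rule generic_iso[OF g0 _ ij ji ij']) simp
    have "Comp E B (EO T A) (EO T X) (EA T A X ?a) ?g =
        Comp E B (EO T A0) (EO T X) (EA T A0 X (Comp E A0 A X ?a i)) g0"
      by (simp add: T.AMap_Comp[of A0 A X] Comp_assoc)
    also have "Comp E A0 A X ?a i = a0" by (simp add: ji flip: Comp_assoc)
    finally have fac: "Comp E B (EO T A) (EO T X) (EA T A X ?a) ?g = Comp E B (EO S X) (EO T X) (\<phi> X) h"
      by (simp add: fac0)
    obtain g where "generic E S B A g" "Comp E B (EO S A) (EO S X) (EA S A X ?a) g = h"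
      by (rule generic_factorisation_over[OF \<phi> X _ h gen fac]) simp
    then show "\<exists>A\<in>\<A>T. \<exists>a\<in>Hom E A X. \<exists>g. generic E S B A g \<and>
        Comp E B (EO S A) (EO S X) (EA S A X a) g = h"
      using A by (intro bexI[of _ A] bexI[of _ ?a] exI[of _ g]) auto
  qed
  ultimately show ?thesis by blast
qed

end
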